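(* For every positive integer $N$ there exists a Jordan curve $\Lambda$ on $S^2_\infty$ such that there are at least $2^N$ distinct complete minimal surfaces in $\mathbb{H}^3$ each having asymptotic boundary $\Lambda$.
   Context: $\mathbb{H}^3$ is hyperbolic three-space, compactified as $\overline{\mathbb{H}^3}=\mathbb{H}^3\cup S^2_\infty$, where $S^2_\infty$ is the sphere at infinity. The asymptotic boundary of a subset $X\subset\mathbb{H}^3$ is $\partial_\infty X=\overline{X}\cap S^2_\infty$, with $\overline{X}$ the closure of $X$ in $\overline{\mathbb{H}^3}$. A minimal surface is an immersed surface with mean curvature identically zero. *)

theory Defs
  imports "HOL-Analysis.Analysis"
begin

section \<open>Hyperbolic three-space\<close>

text \<open>
  We use the Poincare ball model: \<open>\<H>\<^sup>3\<close> is the open unit ball of \<open>\<real>\<^sup>3\<close> with the metric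
  \<open>4 |dx|\<^sup>2 / (1 - |x|\<^sup>2)\<^sup>2\<close>, the sphere at infinity is the unit sphere, and the compactification
  is the closed unit ball with its Euclidean topology.
\<close>

definition hyp3 :: "(real^3) set" where
  "hyp3 = ball 0 1"

definition sphere_at_infinity :: "(real^3) set" where
  "sphere_at_infinity = sphere 0 1"

definition hyp_metric :: "real^3 \<Rightarrow> real^3 \<Rightarrow> real^3 \<Rightarrow> real" where
  "hyp_metric x v w = (2 / (1 - (norm x)\<^sup>2))\<^sup>2 * (v \<bullet> w)"

definition hyp_norm :: "real^3 \<Rightarrow> real^3 \<Rightarrow> real" where
  "hyp_norm x v = sqrt (hyp_metric x v v)"

text \<open>
  The closed unit ball is closed in \<open>\<real>\<^sup>3\<close>, so the Euclidean closure of a subset of \<open>\<H>\<^sup>3\<close> is its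
  closure in the compactification.
\<close>

definition asymptotic_boundary :: "(real^3) set \<Rightarrow> (real^3) set" where
  "asymptotic_boundary X = closure X \<inter> sphere_at_infinity"

definition jordan_curve_at_infinity :: "(real^3) set \<Rightarrow> bool" where
  "jordan_curve_at_infinity \<Lambda> \<longleftrightarrow>
     \<Lambda> \<subseteq> sphere_at_infinity \<and>
     (\<exists>c. simple_path c \<and> pathfinish c = pathstart c \<and> path_image c = \<Lambda>)"

text \<open>
  Christoffel symbols of the first kind, by the Koszul formula for constant vector fields:
  this is \<open>\<langle>\<nabla>\<^sub>u v, w\<rangle>\<close> at \<open>x\<close>, where \<open>\<nabla>\<close> is the Levi-Civita connection of the hyperbolic metric.
\<close>

definition hyp_metric_deriv :: "real^3 \<Rightarrow> real^3 \<Rightarrow> real^3 \<Rightarrow> real^3 \<Rightarrow> real" where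
  "hyp_metric_deriv x u v w = frechet_derivative (\<lambda>y. hyp_metric y v w) (at x) u"

definition hyp_christoffel :: "real^3 \<Rightarrow> real^3 \<Rightarrow> real^3 \<Rightarrow> real^3 \<Rightarrow> real" where
  "hyp_christoffel x u v w =
     (hyp_metric_deriv x u v w + hyp_metric_deriv x v u w - hyp_metric_deriv x w u v) / 2"


section \<open>Local surface theory in hyperbolic three-space\<close>

fun Ck_on :: "nat \<Rightarrow> ('a::euclidean_space \<Rightarrow> 'b::euclidean_space) \<Rightarrow> 'a set \<Rightarrow> bool" where
  "Ck_on 0 f S \<longleftrightarrow> continuous_on S f"
| "Ck_on (Suc k) f S \<longleftrightarrow>
     (\<forall>x\<in>S. f differentiable (at x)) \<and>
     (\<forall>v. Ck_on k (\<lambda>x. frechet_derivative f (at x) v) S)"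

text \<open>Only used for open \<open>S\<close>.\<close>

definition smooth_on :: "('a::euclidean_space \<Rightarrow> 'b::euclidean_space) \<Rightarrow> 'a set \<Rightarrow> bool" where
  "smooth_on f S \<longleftrightarrow> (\<forall>k. Ck_on k f S)"

definition partial_deriv :: "2 \<Rightarrow> (real^2 \<Rightarrow> real^3) \<Rightarrow> real^2 \<Rightarrow> real^3" where
  "partial_deriv i F u = frechet_derivative F (at u) (axis i 1)"

text \<open>
  The hyperbolic metric is conformal to the Euclidean one, so the Euclidean cross product of the
  coordinate tangent vectors is also orthogonal to the surface in the hyperbolic sense; only its
  length has to be normalised hyperbolically.
\<close>

definition unit_normal :: "(real^2 \<Rightarrow> real^3) \<Rightarrow> real^2 \<Rightarrow> real^3" where
  "unit_normal F u =
     (let c = cross3 (partial_deriv 1 F u) (partial_deriv 2 F u) in (1 / hyp_norm (F u) c) *\<^sub>R c)"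

definition first_form :: "(real^2 \<Rightarrow> real^3) \<Rightarrow> real^2 \<Rightarrow> 2 \<Rightarrow> 2 \<Rightarrow> real" where
  "first_form F u i j = hyp_metric (F u) (partial_deriv i F u) (partial_deriv j F u)"

text \<open>\<open>\<langle>\<nabla>\<^sub>i \<partial>\<^sub>j F, n\<rangle>\<close>, with the covariant derivative taken along \<open>F\<close>.\<close>

definition second_form :: "(real^2 \<Rightarrow> real^3) \<Rightarrow> real^2 \<Rightarrow> 2 \<Rightarrow> 2 \<Rightarrow> real" where
  "second_form F u i j =
     hyp_metric (F u) (partial_deriv i (partial_deriv j F) u) (unit_normal F u) +
     hyp_christoffel (F u) (partial_deriv i F u) (partial_deriv j F u) (unit_normal F u)"

text \<open>Half the trace of the shape operator.\<close>

definition mean_curvature :: "(real^2 \<Rightarrow> real^3) \<Rightarrow> real^2 \<Rightarrow> real" where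
  "mean_curvature F u =
     (second_form F u 1 1 * first_form F u 2 2
      - 2 * second_form F u 1 2 * first_form F u 1 2
      + second_form F u 2 2 * first_form F u 1 1) /
     (2 * (first_form F u 1 1 * first_form F u 2 2 - (first_form F u 1 2)\<^sup>2))"


section \<open>Smooth surfaces and their immersions\<close>

text \<open>
  A chart is a pair \<open>(U, \<phi>)\<close> of an open set and a map which is a homeomorphism from \<open>U\<close> onto an
  open subset of the plane; values of \<open>\<phi>\<close> outside \<open>U\<close> are irrelevant.
\<close>

type_synonym 'p chart = "'p set \<times> ('p \<Rightarrow> real^2)"

definition chart_on :: "'p topology \<Rightarrow> 'p chart \<Rightarrow> bool" where
  "chart_on M c \<longleftrightarrow>
     (case c of (U, \<phi>) \<Rightarrow>
        openin M U \<and> open (\<phi> ` U) \<and>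
        homeomorphic_map (subtopology M U) (top_of_set (\<phi> ` U)) \<phi>)"

text \<open>Connected smooth surfaces without boundary, given by a (not necessarily maximal) atlas.\<close>

definition smooth_surface :: "'p topology \<Rightarrow> 'p chart set \<Rightarrow> bool" where
  "smooth_surface M A \<longleftrightarrow>
     connected_space M \<and> Hausdorff_space M \<and> second_countable M \<and>
     (\<forall>c\<in>A. chart_on M c) \<and>
     topspace M = (\<Union>(U, \<phi>)\<in>A. U) \<and>
     (\<forall>(U, \<phi>)\<in>A. \<forall>(W, \<psi>)\<in>A. smooth_on (\<psi> \<circ> inv_into U \<phi>) (\<phi> ` (U \<inter> W)))"

definition immersion_hyp3 :: "'p topology \<Rightarrow> 'p chart set \<Rightarrow> ('p \<Rightarrow> real^3) \<Rightarrow> bool" where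
  "immersion_hyp3 M A f \<longleftrightarrow>
     f ` topspace M \<subseteq> hyp3 \<and>
     (\<forall>(U, \<phi>)\<in>A.
        smooth_on (f \<circ> inv_into U \<phi>) (\<phi> ` U) \<and>
        (\<forall>u\<in>\<phi> ` U. inj (frechet_derivative (f \<circ> inv_into U \<phi>) (at u))))"

definition minimal_immersion :: "'p topology \<Rightarrow> 'p chart set \<Rightarrow> ('p \<Rightarrow> real^3) \<Rightarrow> bool" where
  "minimal_immersion M A f \<longleftrightarrow>
     immersion_hyp3 M A f \<and>
     (\<forall>(U, \<phi>)\<in>A. \<forall>u\<in>\<phi> ` U. mean_curvature (f \<circ> inv_into U \<phi>) u = 0)"

definition piecewise_C1_curve ::
    "'p topology \<Rightarrow> 'p chart set \<Rightarrow> (real \<Rightarrow> 'p) \<Rightarrow> bool" where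
  "piecewise_C1_curve M A \<gamma> \<longleftrightarrow>
     continuous_map (top_of_set {0..1}) M \<gamma> \<and>
     (\<forall>(U, \<phi>)\<in>A. \<forall>a b. 0 \<le> a \<and> a \<le> b \<and> b \<le> 1 \<and> \<gamma> ` {a..b} \<subseteq> U
        \<longrightarrow> (\<phi> \<circ> \<gamma>) piecewise_C1_differentiable_on {a..b})"

text \<open>
  Riemannian distance of the pulled-back metric. The speed of \<open>\<gamma>\<close> in the pulled-back metric is the
  hyperbolic speed of \<open>f \<circ> \<gamma>\<close>. The library's piecewise \<open>C\<^sup>1\<close> maps may have unbounded derivative
  near a break point; \<open>has_integral\<close> leaves out the curves of infinite length among them.
\<close>

definition surface_dist ::
    "'p topology \<Rightarrow> 'p chart set \<Rightarrow> ('p \<Rightarrow> real^3) \<Rightarrow> 'p \<Rightarrow> 'p \<Rightarrow> real" where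
  "surface_dist M A f p q =
     Inf {L. \<exists>\<gamma>. piecewise_C1_curve M A \<gamma> \<and> \<gamma> 0 = p \<and> \<gamma> 1 = q \<and>
               ((\<lambda>t. hyp_norm (f (\<gamma> t)) (vector_derivative (f \<circ> \<gamma>) (at t))) has_integral L) {0..1}}"

text \<open>
  Surfaces in \<open>\<H>\<^sup>3\<close> are regarded as subsets, namely as images of immersions. A connected surface
  has at most the cardinality of the continuum, so taking \<open>real^2\<close> as the type of its points (with
  an arbitrary topology \<open>M\<close> on an arbitrary carrier) is no restriction.
\<close>

definition complete_minimal_surface :: "(real^3) set \<Rightarrow> bool" where
  "complete_minimal_surface S \<longleftrightarrow>
     (\<exists>(M :: (real^2) topology) A f.
        smooth_surface M A \<and> minimal_immersion M A f \<and>
        Metric_space.mcomplete (topspace M) (surface_dist M A f) \<and>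
        S = f ` topspace M)"

end

theory Submission
  imports Defs
begin

text \<open>
  Minimal surfaces invariant under the screw motions \<open>(\<phi>, t) \<mapsto> (\<phi> + a s, t + s)\<close> along a geodesic
  correspond to geodesics of a rotationally symmetric metric on the orbit space. By Clairaut's relation
  there is one such geodesic for each constant \<open>c > 0\<close>, up to rotation; it sweeps out a total angle
  \<open>\<Theta>(c)\<close> around the axis, finite and continuous in \<open>c\<close>, and may wind around it many times. The two
  ends of the surface are asymptotic to two spirals on the sphere at infinity, and these are
  opposite whenever \<open>\<Theta>(c)\<close> is an odd multiple of \<open>\<pi>\<close>: all such surfaces have the same asymptotic
  boundary. As \<open>\<Theta>(1) \<ge> a / 2\<close> and \<open>\<Theta>((1 + a\<^sup>2) / 2) \<le> \<pi>\<close>, for large \<open>a\<close> the intermediate value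
  theorem gives \<open>\<Theta>(c) = (2 k + 1) \<pi>\<close> for every \<open>k < 2 ^ N\<close>. The surfaces differ because
  \<open>c = sinh r cosh r\<close> for the minimal distance \<open>r\<close> to the axis.
\<close>

section \<open>Functions of two variables\<close>

text \<open>Two effects give \<open>total_angle\<close> its range. For large \<open>a\<close> the
  Killing field is dominated by its rotational part, so the angular velocity of the generating
  geodesic grows like \<open>a\<close> while \<open>c\<close> stays fixed. For fixed
  \<open>a\<close> and large \<open>c\<close> the curve stays far from the axis, where the same
  velocity decays like the inverse square root of \<open>cosh 2r\<close>. The angle is centred so
  that the ends of each curve tend to plus and minus half of \<open>total_angle\<close>. For an odd
  multiple of pi these are the directions plus and minus pi/2 modulo 2 pi, whatever the multiple, so
  the number of windings leaves no trace at infinity. Winding curves may cross themselves, so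
  nothing below relies on embeddedness: each surface is an immersion of the whole plane with a
  single chart. Only the angle lacks a closed form, and it enters through its derivative and through
  sine and cosine alone. Minimality therefore reduces to polynomial identities once it is tested on
  the hyperboloid, where no normal has to be computed.\<close>

definition has_partials ::
    "(real^2 \<Rightarrow> 'a::real_normed_vector) \<Rightarrow> (real^2 \<Rightarrow> 'a) \<Rightarrow> (real^2 \<Rightarrow> 'a) \<Rightarrow> bool" where
  "has_partials f f1 f2 \<longleftrightarrow>
     (\<forall>u. (f has_derivative (\<lambda>v. v $ 1 *\<^sub>R f1 u + v $ 2 *\<^sub>R f2 u)) (at u))"

lemma has_partialsD:
  "has_partials f f1 f2 \<Longrightarrow> (f has_derivative (\<lambda>v. v $ 1 *\<^sub>R f1 u + v $ 2 *\<^sub>R f2 u)) (at u)"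
  by (simp add: has_partials_def)

lemma has_partials_frechet:
  "has_partials f f1 f2 \<Longrightarrow> frechet_derivative f (at u) = (\<lambda>v. v $ 1 *\<^sub>R f1 u + v $ 2 *\<^sub>R f2 u)"
  by (rule frechet_derivative_at[OF has_partialsD, symmetric])

lemma has_partials_partial_deriv:
  assumes "has_partials f f1 f2"
  shows "partial_deriv 1 f = f1" "partial_deriv 2 f = f2"
  by (auto simp: partial_deriv_def has_partials_frechet[OF assms] axis_def)

lemma has_partials_isCont: "has_partials f f1 f2 \<Longrightarrow> isCont f u"
  using has_derivative_continuous has_partialsD by blast

lemma has_partials_cong:
  "has_partials f f1 f2 \<Longrightarrow> (\<And>u. f1 u = g1 u) \<Longrightarrow> (\<And>u. f2 u = g2 u) \<Longrightarrow> has_partials f g1 g2"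
  by (simp add: has_partials_def)

lemma has_partials_const: "has_partials (\<lambda>u. k) (\<lambda>u. 0) (\<lambda>u. 0)"
  by (simp add: has_partials_def)

lemma has_partials_nth:
  "has_partials (\<lambda>u. u $ 1) (\<lambda>u. 1) (\<lambda>u. 0)" "has_partials (\<lambda>u. u $ 2) (\<lambda>u. 0) (\<lambda>u. 1)"
  by (auto simp: has_partials_def bounded_linear_imp_has_derivative bounded_linear_vec_nth)

lemma has_partials_add:
  assumes "has_partials f f1 f2" "has_partials g g1 g2"
  shows "has_partials (\<lambda>u. f u + g u) (\<lambda>u. f1 u + g1 u) (\<lambda>u. f2 u + g2 u)"
  unfolding has_partials_def
  by (intro allI has_derivative_eq_rhs[OF has_derivative_add[OF assms[THEN has_partialsD]]])
    (simp add: fun_eq_iff scaleR_add_right)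

lemma has_partials_diff:
  assumes "has_partials f f1 f2" "has_partials g g1 g2"
  shows "has_partials (\<lambda>u. f u - g u) (\<lambda>u. f1 u - g1 u) (\<lambda>u. f2 u - g2 u)"
  unfolding has_partials_def
  by (intro allI has_derivative_eq_rhs[OF has_derivative_diff[OF assms[THEN has_partialsD]]])
    (simp add: fun_eq_iff scaleR_diff_right)

lemma has_partials_scaleR:
  fixes f :: "real^2 \<Rightarrow> real"
  assumes "has_partials f f1 f2" "has_partials g g1 g2"
  shows "has_partials (\<lambda>u. f u *\<^sub>R g u)
    (\<lambda>u. f1 u *\<^sub>R g u + f u *\<^sub>R g1 u) (\<lambda>u. f2 u *\<^sub>R g u + f u *\<^sub>R g2 u)"
  unfolding has_partials_def
  by (intro allI has_derivative_eq_rhs[OF has_derivative_scaleR[OF assms[THEN has_partialsD]]])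
    (simp add: fun_eq_iff scaleR_add_right scaleR_add_left mult.commute)

lemma has_partials_mult:
  fixes f g :: "real^2 \<Rightarrow> real"
  shows "has_partials f f1 f2 \<Longrightarrow> has_partials g g1 g2 \<Longrightarrow>
   has_partials (\<lambda>u. f u * g u) (\<lambda>u. f1 u * g u + f u * g1 u) (\<lambda>u. f2 u * g u + f u * g2 u)"
  using has_partials_scaleR[of f f1 f2 g g1 g2] by simp

lemma has_partials_chain:
  fixes f :: "real^2 \<Rightarrow> real"
  assumes "has_partials f f1 f2" "\<And>u. (g has_real_derivative g' u) (at (f u))"
  shows "has_partials (\<lambda>u. g (f u)) (\<lambda>u. g' u * f1 u) (\<lambda>u. g' u * f2 u)"
  unfolding has_partials_def
proof
  fix u
  have "((\<lambda>x. g (f x)) has_derivative (\<lambda>v. (v $ 1 * f1 u + v $ 2 * f2 u) * g' u)) (at u)"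
    using has_derivative_compose[OF has_partialsD[OF assms(1), of u] assms(2)[of u, unfolded has_field_derivative_def]]
    by (simp add: mult.commute)
  then show "((\<lambda>u. g (f u)) has_derivative
      (\<lambda>v. v $ 1 *\<^sub>R (g' u * f1 u) + v $ 2 *\<^sub>R (g' u * f2 u))) (at u)"
    by (simp add: algebra_simps)
qed

lemma has_partials_fst:
  "(\<And>p. (g has_real_derivative g' p) (at p)) \<Longrightarrow> has_partials (\<lambda>u. g (u $ 1)) (\<lambda>u. g' (u $ 1)) (\<lambda>u. 0)"
  using has_partials_chain[OF has_partials_nth(1), of g "\<lambda>u. g' (u $ 1)"] by simp

lemma has_partials_snd:
  "(\<And>t. (g has_real_derivative g' t) (at t)) \<Longrightarrow> has_partials (\<lambda>u. g (u $ 2)) (\<lambda>u. 0) (\<lambda>u. g' (u $ 2))"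
  using has_partials_chain[OF has_partials_nth(2), of g "\<lambda>u. g' (u $ 2)"] by simp

lemma has_partials_inverse:
  fixes f :: "real^2 \<Rightarrow> real"
  assumes "has_partials f f1 f2" "\<And>u. f u \<noteq> 0"
  shows "has_partials (\<lambda>u. 1 / f u) (\<lambda>u. - f1 u / (f u)\<^sup>2) (\<lambda>u. - f2 u / (f u)\<^sup>2)"
proof -
  have "((\<lambda>x. 1 / x) has_real_derivative - (1 / (f u)\<^sup>2)) (at (f u))" for u
    using assms(2)[of u] by (auto intro!: derivative_eq_intros simp: power2_eq_square)
  from has_partials_chain[OF assms(1) this] show ?thesis by simp
qed

lemma has_derivative_vector3:
  fixes f g h :: "'a::real_normed_vector \<Rightarrow> real"
  assumes "(f has_derivative f') F" "(g has_derivative g') F" "(h has_derivative h') F"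
  shows "((\<lambda>x. vector [f x, g x, h x] :: real^3) has_derivative (\<lambda>v. vector [f' v, g' v, h' v])) F"
proof -
  have v3: "(vector [a, b, c] :: real^3) = a *\<^sub>R axis 1 1 + b *\<^sub>R axis 2 1 + c *\<^sub>R axis 3 1" for a b c
    by (simp add: vec_eq_iff forall_3 axis_def)
  show ?thesis unfolding v3 by (intro derivative_intros assms)
qed

lemma has_partials_vector3:
  assumes "has_partials f f1 f2" "has_partials g g1 g2" "has_partials h h1 h2"
  shows "has_partials (\<lambda>u. vector [f u, g u, h u] :: real^3)
           (\<lambda>u. vector [f1 u, g1 u, h1 u]) (\<lambda>u. vector [f2 u, g2 u, h2 u])"
proof -
  have *: "(vector [x * a + y * a', x * b + y * b', x * c + y * c'] :: real^3) =
     x *\<^sub>R vector [a, b, c] + y *\<^sub>R vector [a', b', c']" for x y a b c a' b' c'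
    by (simp add: vec_eq_iff forall_3)
  show ?thesis
    using assms has_derivative_vector3 unfolding has_partials_def real_scaleR_def *[symmetric] by blast
qed

section \<open>Smoothness through families closed under differentiation\<close>

lemma smooth_on_coinduct:
  assumes "f \<in> K"
    and "\<And>f x. f \<in> K \<Longrightarrow> f differentiable (at x)"
    and "\<And>f v. f \<in> K \<Longrightarrow> (\<lambda>x. frechet_derivative f (at x) v) \<in> K"
  shows "smooth_on f S"
proof -
  have "Ck_on k f S" if "f \<in> K" for k f
    using that
  proof (induction k arbitrary: f)
    case 0
    then show ?case
      using assms(2) by (auto intro!: continuous_at_imp_continuous_on differentiable_imp_continuous_within)
  next
    case (Suc k)
    then show ?case using assms(2,3) by simp
  qed
  then show ?thesis using assms(1) by (simp add: smooth_on_def)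
qed

inductive_set gen_algebra :: "('a \<Rightarrow> real) set \<Rightarrow> ('a \<Rightarrow> real) set" for B where
  base: "f \<in> B \<Longrightarrow> f \<in> gen_algebra B"
| const: "(\<lambda>x. k) \<in> gen_algebra B"
| add: "f \<in> gen_algebra B \<Longrightarrow> g \<in> gen_algebra B \<Longrightarrow> (\<lambda>x. f x + g x) \<in> gen_algebra B"
| mult: "f \<in> gen_algebra B \<Longrightarrow> g \<in> gen_algebra B \<Longrightarrow> (\<lambda>x. f x * g x) \<in> gen_algebra B"

lemma gen_algebra_partials:
  assumes "\<And>b. b \<in> B \<Longrightarrow> \<exists>b1\<in>gen_algebra B. \<exists>b2\<in>gen_algebra B. has_partials b b1 b2"
    and "f \<in> gen_algebra B"
  shows "\<exists>f1\<in>gen_algebra B. \<exists>f2\<in>gen_algebra B. has_partials f f1 f2"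
  using assms(2)
proof induction
  case (base f)
  then show ?case using assms(1) by blast
next
  case (const k)
  then show ?case using has_partials_const gen_algebra.const by blast
next
  case (add f g)
  then obtain f1 f2 g1 g2 where *: "f1 \<in> gen_algebra B" "f2 \<in> gen_algebra B"
    "g1 \<in> gen_algebra B" "g2 \<in> gen_algebra B" "has_partials f f1 f2" "has_partials g g1 g2" by blast
  show ?case
    by (rule bexI[where x = "\<lambda>u. f1 u + g1 u"], rule bexI[where x = "\<lambda>u. f2 u + g2 u"])
      (intro has_partials_add gen_algebra.add * )+
next
  case (mult f g)
  then obtain f1 f2 g1 g2 where *: "f1 \<in> gen_algebra B" "f2 \<in> gen_algebra B"
    "g1 \<in> gen_algebra B" "g2 \<in> gen_algebra B" "has_partials f f1 f2" "has_partials g g1 g2" by blast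
  show ?case
    by (rule bexI[where x = "\<lambda>u. f1 u * g u + f u * g1 u"],
        rule bexI[where x = "\<lambda>u. f2 u * g u + f u * g2 u"])
      (intro has_partials_mult gen_algebra.add gen_algebra.mult * mult.hyps)+
qed

lemma smooth_on_vector3_gen_algebra:
  assumes B: "\<And>b. b \<in> B \<Longrightarrow> \<exists>b1\<in>gen_algebra B. \<exists>b2\<in>gen_algebra B. has_partials b b1 b2"
    and "f \<in> gen_algebra B" "g \<in> gen_algebra B" "h \<in> gen_algebra B"
  shows "smooth_on (\<lambda>u. vector [f u, g u, h u] :: real^3) S"
proof -
  let ?K = "{\<lambda>u. vector [f u, g u, h u] :: real^3 | f g h.
    f \<in> gen_algebra B \<and> g \<in> gen_algebra B \<and> h \<in> gen_algebra B}"
  have K: "(\<lambda>u. vector [f u, g u, h u]) \<in> ?K"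
    if "f \<in> gen_algebra B" "g \<in> gen_algebra B" "h \<in> gen_algebra B" for f g h
    using that by blast
  have *: "F differentiable (at u) \<and> (\<lambda>x. frechet_derivative F (at x) v) \<in> ?K" if "F \<in> ?K" for F u v
  proof -
    from that obtain f g h where F: "F = (\<lambda>u. vector [f u, g u, h u])"
      and "f \<in> gen_algebra B" "g \<in> gen_algebra B" "h \<in> gen_algebra B" by blast
    then obtain f1 f2 g1 g2 h1 h2 where m:
      "f1 \<in> gen_algebra B" "f2 \<in> gen_algebra B" "g1 \<in> gen_algebra B" "g2 \<in> gen_algebra B"
      "h1 \<in> gen_algebra B" "h2 \<in> gen_algebra B" and
      p: "has_partials f f1 f2" "has_partials g g1 g2" "has_partials h h1 h2"
      using gen_algebra_partials[OF B, of f] gen_algebra_partials[OF B, of g]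
        gen_algebra_partials[OF B, of h] by blast
    have D: "has_partials F (\<lambda>u. vector [f1 u, g1 u, h1 u]) (\<lambda>u. vector [f2 u, g2 u, h2 u])"
      unfolding F by (intro has_partials_vector3 p)
    have comb: "(\<lambda>u. v $ 1 * k1 u + v $ 2 * k2 u) \<in> gen_algebra B"
      if "k1 \<in> gen_algebra B" "k2 \<in> gen_algebra B" for k1 k2
      using that by (intro gen_algebra.add gen_algebra.mult gen_algebra.const)
    have "(\<lambda>x. frechet_derivative F (at x) v) = (\<lambda>u. vector [v $ 1 * f1 u + v $ 2 * f2 u,
       v $ 1 * g1 u + v $ 2 * g2 u, v $ 1 * h1 u + v $ 2 * h2 u])"
      by (simp add: has_partials_frechet[OF D] fun_eq_iff vec_eq_iff forall_3)
    moreover have "(\<lambda>u. vector [v $ 1 * f1 u + v $ 2 * f2 u,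
       v $ 1 * g1 u + v $ 2 * g2 u, v $ 1 * h1 u + v $ 2 * h2 u]) \<in> ?K"
      by (intro K comb m)
    ultimately show ?thesis
      using has_partialsD[OF D, of u] by (auto simp: differentiable_def)
  qed
  show ?thesis by (rule smooth_on_coinduct[OF K[OF assms(2-4)]]) (use * in simp_all)
qed

lemma inner_vector3:
  "(vector [a1, a2, a3] :: real^3) \<bullet> vector [b1, b2, b3] = a1 * b1 + a2 * b2 + a3 * b3"
  by (simp add: inner_vec_def sum_3)

section \<open>Mean curvature in the ball and hyperboloid models\<close>

text \<open>The conformal factor \<open>l = 2 / (1 - (norm x)\<^sup>2)\<close> has derivative
  \<open>l\<^sup>2 * (x \<bullet> u)\<close> in direction \<open>u\<close>. Of the three Koszul
  terms only the one containing \<open>u \<bullet> v\<close> survives when \<open>n\<close> is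
  orthogonal to both arguments.\<close>

lemma hyp_christoffel_orthogonal:
  fixes x u v n :: "real^3"
  assumes "norm x < 1" "u \<bullet> n = 0" "v \<bullet> n = 0"
  shows "hyp_christoffel x u v n = - ((2 / (1 - (norm x)\<^sup>2)) ^ 3 * (x \<bullet> n) * (u \<bullet> v))"
proof -
  have nz: "1 - x \<bullet> x \<noteq> 0"
    using assms(1) abs_square_less_1[of "norm x"] by (simp add: power2_norm_eq_inner)
  have "((\<lambda>s. (2 / (1 - s))\<^sup>2 * k) has_real_derivative (2 / (1 - x \<bullet> x)) ^ 3 * k) (at (x \<bullet> x))" for k :: real
    using nz by (auto intro!: derivative_eq_intros) (simp add: field_simps power2_eq_square power3_eq_cube)
  then have D: "((\<lambda>s. (2 / (1 - s))\<^sup>2 * k) has_derivative (*) ((2 / (1 - x \<bullet> x)) ^ 3 * k)) (at (x \<bullet> x))" for k :: real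
    by (simp add: has_field_derivative_def)
  have "((\<lambda>y. (2 / (1 - y \<bullet> y))\<^sup>2 * k) has_derivative
      (\<lambda>a. 2 * (2 / (1 - (norm x)\<^sup>2)) ^ 3 * (x \<bullet> a) * k)) (at x)" for k
  proof -
    have "((\<lambda>y. y \<bullet> y) has_derivative (\<lambda>a. 2 * (x \<bullet> a))) (at x)"
      by (auto intro!: derivative_eq_intros simp: inner_commute)
    from has_derivative_compose[OF this D] show ?thesis by (simp add: power2_norm_eq_inner mult_ac)
  qed
  then have "hyp_metric_deriv x a b d = 2 * (2 / (1 - (norm x)\<^sup>2)) ^ 3 * (x \<bullet> a) * (b \<bullet> d)" for a b d
    unfolding hyp_metric_deriv_def hyp_metric_def power2_norm_eq_inner
    by (subst frechet_derivative_at[symmetric]) auto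
  then show ?thesis
    using assms(2,3) by (simp add: hyp_christoffel_def)
qed

text \<open>Pairing with the normal kills the tangential terms, so \<open>a\<close> and
  \<open>b\<close> are free and the normal is never computed. The Christoffel terms subtract a
  multiple of the first fundamental form, whose trace is what the coefficient of \<open>F u\<close>
  compensates.\<close>

lemma mean_curvature_eq_0:
  fixes F F1 F2 F11 F12 F21 F22
  assumes F: "has_partials F F1 F2" "has_partials F1 F11 F12" "has_partials F2 F21 F22"
    and ball: "norm (F u) < 1"
    and lin: "(F2 u \<bullet> F2 u) *\<^sub>R F11 u - (2 * (F1 u \<bullet> F2 u)) *\<^sub>R F21 u + (F1 u \<bullet> F1 u) *\<^sub>R F22 u =
      a *\<^sub>R F1 u + b *\<^sub>R F2 u +
      (4 / (1 - (norm (F u))\<^sup>2) * ((F1 u \<bullet> F1 u) * (F2 u \<bullet> F2 u) - (F1 u \<bullet> F2 u)\<^sup>2)) *\<^sub>R F u"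
  shows "mean_curvature F u = 0"
proof -
  define n where "n = unit_normal F u"
  define l where "l = 2 / (1 - (norm (F u))\<^sup>2)"
  note pd = has_partials_partial_deriv
  have n: "F1 u \<bullet> n = 0" "F2 u \<bullet> n = 0"
    by (simp_all add: n_def unit_normal_def Let_def pd[OF F(1)] dot_cross_self)
  have h: "hyp_metric (F u) x y = l\<^sup>2 * (x \<bullet> y)" for x y
    by (simp add: hyp_metric_def l_def)
  have chr: "hyp_christoffel (F u) x y n = - (l ^ 3 * (F u \<bullet> n) * (x \<bullet> y))"
    if "x \<bullet> n = 0" "y \<bullet> n = 0" for x y
    using hyp_christoffel_orthogonal[OF ball that] by (simp add: l_def)
  have ff: "first_form F u 1 1 = l\<^sup>2 * (F1 u \<bullet> F1 u)" "first_form F u 1 2 = l\<^sup>2 * (F1 u \<bullet> F2 u)"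
    "first_form F u 2 2 = l\<^sup>2 * (F2 u \<bullet> F2 u)"
    by (simp_all add: first_form_def pd[OF F(1)] h)
  have sf: "second_form F u 1 1 = l\<^sup>2 * (F11 u \<bullet> n) - l ^ 3 * (F u \<bullet> n) * (F1 u \<bullet> F1 u)"
    "second_form F u 1 2 = l\<^sup>2 * (F21 u \<bullet> n) - l ^ 3 * (F u \<bullet> n) * (F1 u \<bullet> F2 u)"
    "second_form F u 2 2 = l\<^sup>2 * (F22 u \<bullet> n) - l ^ 3 * (F u \<bullet> n) * (F2 u \<bullet> F2 u)"
    by (simp_all add: second_form_def pd[OF F(1)] pd[OF F(2)] pd[OF F(3)] h chr n n_def[symmetric])
  define e where "e = F1 u \<bullet> F1 u"
  define f where "f = F1 u \<bullet> F2 u"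
  define g where "g = F2 u \<bullet> F2 u"
  define D where "D = e * g - f\<^sup>2"
  have "((F2 u \<bullet> F2 u) *\<^sub>R F11 u - (2 * (F1 u \<bullet> F2 u)) *\<^sub>R F21 u + (F1 u \<bullet> F1 u) *\<^sub>R F22 u) \<bullet> n =
      2 * l * D * (F u \<bullet> n)"
    unfolding lin by (simp add: inner_add_left n l_def D_def e_def f_def g_def)
  then have *: "g * (F11 u \<bullet> n) - 2 * f * (F21 u \<bullet> n) + e * (F22 u \<bullet> n) = 2 * l * D * (F u \<bullet> n)"
    by (simp add: inner_add_left inner_diff_left e_def f_def g_def)
  have "second_form F u 1 1 * first_form F u 2 2 - 2 * second_form F u 1 2 * first_form F u 1 2
      + second_form F u 2 2 * first_form F u 1 1 =
      l ^ 4 * (g * (F11 u \<bullet> n) - 2 * f * (F21 u \<bullet> n) + e * (F22 u \<bullet> n) - 2 * l * D * (F u \<bullet> n))"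
    unfolding ff sf e_def[symmetric] f_def[symmetric] g_def[symmetric] D_def
    by algebra
  also have "\<dots> = 0" using * by simp
  finally show ?thesis by (simp add: mean_curvature_def)
qed

text \<open>
  In the lemmas on stereographic projection, \<open>(h - 1, Y)\<close> is a point of the hyperboloid model in
  Minkowski space and \<open>Y / h\<close> is the corresponding point of the ball.
\<close>

lemma hyp_metric_stereographic:
  fixes Y V W :: "real^3" and h a b :: real
  assumes h: "h > 1" "(h - 1)\<^sup>2 = 1 + Y \<bullet> Y" and a: "(h - 1) * a = Y \<bullet> V" and b: "(h - 1) * b = Y \<bullet> W"
  defines "x \<equiv> (1 / h) *\<^sub>R Y"
  shows "norm x < 1" "2 / (1 - (norm x)\<^sup>2) = h"
    "hyp_metric x ((1 / h) *\<^sub>R (V - a *\<^sub>R x)) ((1 / h) *\<^sub>R (W - b *\<^sub>R x)) = V \<bullet> W - a * b"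
proof -
  have hh: "Y \<bullet> Y = h * (h - 2)"
    using h(2) by (simp add: power2_eq_square algebra_simps)
  have nx: "(norm x)\<^sup>2 = (h - 2) / h"
    using h(1) unfolding x_def power2_norm_eq_inner by (simp add: hh)
  then have "(norm x)\<^sup>2 < 1" using h(1) by simp
  then show "norm x < 1" using abs_square_less_1[of "norm x"] by simp
  show l: "2 / (1 - (norm x)\<^sup>2) = h"
    using h(1) by (simp add: nx field_simps)
  have "x \<bullet> x = (h - 2) / h" "V \<bullet> x = (h - 1) * a / h" "x \<bullet> W = (h - 1) * b / h"
    using a b nx by (simp_all add: x_def inner_commute flip: power2_norm_eq_inner)
  then show "hyp_metric x ((1 / h) *\<^sub>R (V - a *\<^sub>R x)) ((1 / h) *\<^sub>R (W - b *\<^sub>R x)) = V \<bullet> W - a * b"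
    using h(1) unfolding hyp_metric_def l
    by (simp add: inner_diff_left inner_diff_right) (simp add: field_simps power2_eq_square)
qed

lemma has_partials_stereographic:
  fixes Y :: "real^2 \<Rightarrow> real^3"
  assumes "has_partials h h1 h2" "has_partials Y Y1 Y2" "\<And>u. h u \<noteq> 0"
  shows "has_partials (\<lambda>u. (1 / h u) *\<^sub>R Y u)
     (\<lambda>u. (1 / h u) *\<^sub>R (Y1 u - h1 u *\<^sub>R ((1 / h u) *\<^sub>R Y u)))
     (\<lambda>u. (1 / h u) *\<^sub>R (Y2 u - h2 u *\<^sub>R ((1 / h u) *\<^sub>R Y u)))"
  by (rule has_partials_cong[OF has_partials_scaleR[OF has_partials_inverse[OF assms(1,3)] assms(2)]])
    (simp_all add: algebra_simps power2_eq_square)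

text \<open>\<open>linY\<close> and \<open>linh\<close> together form one vector equation in
  Minkowski space, with common tangential coefficients \<open>a\<close> and \<open>b\<close>. It
  says that the Laplacian of the position vector \<open>X\<close> is \<open>2 * X\<close> up to
  tangential terms, the equation of minimal surfaces in the hyperboloid.\<close>

lemma mean_curvature_stereographic_eq_0:
  fixes Y Y1 Y2 Y11 Y12 Y21 Y22 :: "real^2 \<Rightarrow> real^3" and h h1 h2 h11 h12 h21 h22 :: "real^2 \<Rightarrow> real"
  assumes h: "has_partials h h1 h2" "has_partials h1 h11 h12" "has_partials h2 h21 h22"
    and Y: "has_partials Y Y1 Y2" "has_partials Y1 Y11 Y12" "has_partials Y2 Y21 Y22"
    and h_gt: "\<And>u. h u > 1" and hyp: "(h u - 1)\<^sup>2 = 1 + Y u \<bullet> Y u"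
    and tangent: "(h u - 1) * h1 u = Y u \<bullet> Y1 u" "(h u - 1) * h2 u = Y u \<bullet> Y2 u"
    and efg: "e = Y1 u \<bullet> Y1 u - h1 u * h1 u" "f = Y1 u \<bullet> Y2 u - h1 u * h2 u"
      "g = Y2 u \<bullet> Y2 u - h2 u * h2 u"
    and linY: "g *\<^sub>R Y11 u - (2 * f) *\<^sub>R Y21 u + e *\<^sub>R Y22 u =
      a *\<^sub>R Y1 u + b *\<^sub>R Y2 u + (2 * (e * g - f\<^sup>2)) *\<^sub>R Y u"
    and linh: "g * h11 u - 2 * f * h21 u + e * h22 u =
      a * h1 u + b * h2 u + 2 * (e * g - f\<^sup>2) * (h u - 1)"
  shows "mean_curvature (\<lambda>u. (1 / h u) *\<^sub>R Y u) u = 0"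
proof -
  define F where "F = (\<lambda>u. (1 / h u) *\<^sub>R Y u)"
  define F1 where "F1 = (\<lambda>u. (1 / h u) *\<^sub>R (Y1 u - h1 u *\<^sub>R F u))"
  define F2 where "F2 = (\<lambda>u. (1 / h u) *\<^sub>R (Y2 u - h2 u *\<^sub>R F u))"
  have nz: "h v \<noteq> 0" for v using h_gt[of v] by simp
  have pF: "has_partials F F1 F2"
    unfolding F_def F1_def F2_def by (rule has_partials_stereographic[OF h(1) Y(1) nz])
  note D1 = has_partials_diff[OF Y(2) has_partials_scaleR[OF h(2) pF]]
  note D2 = has_partials_diff[OF Y(3) has_partials_scaleR[OF h(3) pF]]
  note pF1 = has_partials_stereographic[OF h(1) D1 nz, folded F1_def]
  note pF2 = has_partials_stereographic[OF h(1) D2 nz, folded F2_def]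
  note st = hyp_metric_stereographic[OF h_gt hyp, folded F_def]
  have FY: "Y u = h u *\<^sub>R F u" using nz by (simp add: F_def)
  have Fu: "(1 / h u) *\<^sub>R Y u = F u" by (simp add: F_def)
  have l: "2 / (1 - (norm (F u))\<^sup>2) = h u" and ball: "norm (F u) < 1"
    using st(1,2)[OF tangent(1) tangent(1)] unfolding F_def by auto
  have m: "(h u)\<^sup>2 * (F1 u \<bullet> F1 u) = e" "(h u)\<^sup>2 * (F1 u \<bullet> F2 u) = f" "(h u)\<^sup>2 * (F2 u \<bullet> F2 u) = g"
    using st(3)[OF tangent(1) tangent(1)] st(3)[OF tangent(1) tangent(2)]
      st(3)[OF tangent(2) tangent(2)] l
    unfolding Fu hyp_metric_def efg F1_def F2_def by simp_all
  define H where "H = h u"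
  have H: "H \<noteq> 0" using nz H_def by simp
  define e' f' g' D' where "e' = F1 u \<bullet> F1 u" and "f' = F1 u \<bullet> F2 u" and "g' = F2 u \<bullet> F2 u"
    and "D' = e' * g' - f'\<^sup>2"
  have m': "e = H\<^sup>2 * e'" "f = H\<^sup>2 * f'" "g = H\<^sup>2 * g'" "e * g - f\<^sup>2 = H ^ 4 * D'"
    using m by (simp_all add: H_def e'_def f'_def g'_def D'_def algebra_simps power2_eq_square eval_nat_numeral)
  have F1u: "F1 u = (1 / h u) *\<^sub>R (Y1 u - h1 u *\<^sub>R F u)" and F2u: "F2 u = (1 / h u) *\<^sub>R (Y2 u - h2 u *\<^sub>R F u)"
    by (simp_all add: F1_def F2_def)
  have l4: "4 / (1 - (norm (F u))\<^sup>2) = 2 * h u" using l by simp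
  have Yi: "Y1 u = H *\<^sub>R F1 u + h1 u *\<^sub>R F u" "Y2 u = H *\<^sub>R F2 u + h2 u *\<^sub>R F u"
    using nz by (simp_all add: F1_def F2_def H_def)
  define F11 F21 F22 where
    "F11 = (1 / H) *\<^sub>R (Y11 u - (h11 u *\<^sub>R F u + h1 u *\<^sub>R F1 u) - h1 u *\<^sub>R F1 u)"
    and "F21 = (1 / H) *\<^sub>R (Y21 u - (h21 u *\<^sub>R F u + h2 u *\<^sub>R F1 u) - h1 u *\<^sub>R F2 u)"
    and "F22 = (1 / H) *\<^sub>R (Y22 u - (h22 u *\<^sub>R F u + h2 u *\<^sub>R F2 u) - h2 u *\<^sub>R F2 u)"
  \<comment> \<open>These are the second derivatives of \<open>Y = h F\<close> by the product rule.
    Inserted into \<open>linY\<close>, they leave terms along \<open>F\<close> that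
    \<open>linh\<close> evaluates, and first-order terms that are tangential.\<close>
  have Yij: "Y11 u = H *\<^sub>R F11 + (2 * h1 u) *\<^sub>R F1 u + h11 u *\<^sub>R F u"
    "Y21 u = H *\<^sub>R F21 + h2 u *\<^sub>R F1 u + h1 u *\<^sub>R F2 u + h21 u *\<^sub>R F u"
    "Y22 u = H *\<^sub>R F22 + (2 * h2 u) *\<^sub>R F2 u + h22 u *\<^sub>R F u"
    using H unfolding F11_def F21_def F22_def by (simp_all add: vec_eq_iff algebra_simps)
  \<comment> \<open>The old tangential coefficients, corrected by the cross terms \<open>h1\<close>,
    \<open>h2\<close> of the product rule. The division by \<open>H ^ 3\<close> comes from one
    factor \<open>H\<close> in \<open>Yij\<close> and from \<open>H\<^sup>2\<close> between the two
    first fundamental forms.\<close>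
  define A B where "A = (a * H - g * 2 * h1 u + 2 * f * h2 u) / H ^ 3"
    and "B = (b * H + 2 * f * h1 u - e * 2 * h2 u) / H ^ 3"
  have "g' *\<^sub>R F11 - (2 * f') *\<^sub>R F21 + e' *\<^sub>R F22 = A *\<^sub>R F1 u + B *\<^sub>R F2 u + (2 * H * D') *\<^sub>R F u"
  proof -
    have c: "g' * F11 $ i - 2 * f' * F21 $ i + e' * F22 $ i = A * F1 u $ i + B * F2 u $ i + 2 * H * D' * F u $ i" for i
    proof -
      have "H ^ 3 * (g' * F11 $ i - 2 * f' * F21 $ i + e' * F22 $ i) =
          g * (Y11 u $ i - 2 * h1 u * F1 u $ i - h11 u * F u $ i)
          - 2 * f * (Y21 u $ i - h2 u * F1 u $ i - h1 u * F2 u $ i - h21 u * F u $ i)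
          + e * (Y22 u $ i - 2 * h2 u * F2 u $ i - h22 u * F u $ i)"
        unfolding Yij m'(1-3) by (simp add: algebra_simps power2_eq_square power3_eq_cube)
      also have "\<dots> = (g *\<^sub>R Y11 u - (2 * f) *\<^sub>R Y21 u + e *\<^sub>R Y22 u) $ i
          - (g * h11 u - 2 * f * h21 u + e * h22 u) * F u $ i
          - (2 * g * h1 u - 2 * f * h2 u) * F1 u $ i + (2 * f * h1 u - 2 * e * h2 u) * F2 u $ i"
        by (simp add: algebra_simps)
      also have "\<dots> = (a * H - g * 2 * h1 u + 2 * f * h2 u) * F1 u $ i
          + (b * H + 2 * f * h1 u - e * 2 * h2 u) * F2 u $ i + 2 * (H ^ 4 * D') * F u $ i"
        unfolding linY linh m'(4) FY Yi by (simp add: algebra_simps H_def)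
      also have "\<dots> = H ^ 3 * (A * F1 u $ i + B * F2 u $ i + 2 * H * D' * F u $ i)"
      proof -
        have "H ^ 3 * A = a * H - g * 2 * h1 u + 2 * f * h2 u" "H ^ 3 * B = b * H + 2 * f * h1 u - e * 2 * h2 u"
          using H by (simp_all add: A_def B_def)
        then show ?thesis
          by (simp only: distrib_left mult.assoc[symmetric]) (simp add: eval_nat_numeral)
      qed
      finally show ?thesis using H by simp
    qed
    show ?thesis by (simp add: vec_eq_iff c)
  qed
  then show ?thesis
    unfolding F_def[symmetric]
    by (intro mean_curvature_eq_0[OF pF pF1 pF2 ball, where a = A and b = B])
      (simp add: e'_def f'_def g'_def D'_def F11_def F21_def F22_def H_def l4 flip: F1u F2u)
qed

section \<open>Completeness of immersed planes\<close>

lemma smooth_surface_plane: "smooth_surface (euclidean :: (real^2) topology) {(UNIV, id)}"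
proof -
  have "second_countable (euclidean :: (real^2) topology)"
  proof -
    obtain \<B> :: "(real^2) set set" where \<B>: "countable \<B>" "topological_basis \<B>"
      using ex_countable_basis[where 'a = "real^2"] by (elim exE conjE)
    have "\<exists>V\<in>\<B>. x \<in> V \<and> V \<subseteq> U" if "open U" "x \<in> U" for U x
      by (rule topological_basisE[OF \<B>(2) that]) (intro bexI conjI)
    then show ?thesis
      unfolding second_countable_def
      by (intro exI[of _ \<B>]) (use \<B> topological_basis_open in auto)
  qed
  moreover have "smooth_on (id :: real^2 \<Rightarrow> real^2) UNIV"
  proof (rule smooth_on_coinduct[where K = "insert id (range (\<lambda>k x. k))"])
    fix f :: "real^2 \<Rightarrow> real^2" and v assume "f \<in> insert id (range (\<lambda>k x. k))"
    then consider "f = id" | k where "f = (\<lambda>x. k)" by blast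
    then have "f differentiable (at x) \<and>
       (\<lambda>x. frechet_derivative f (at x) v) \<in> insert id (range (\<lambda>k x. k))" for x
    proof cases
      case 1
      then show ?thesis by (auto simp: frechet_derivative_id id_def)
    next
      case 2
      then show ?thesis by auto
    qed
    then show "f differentiable (at x)" "(\<lambda>x. frechet_derivative f (at x) v) \<in> insert id (range (\<lambda>k x. k))" for x
      by auto
  qed simp
  moreover have "connected_space (euclidean :: (real^2) topology)"
    using connectedin_topspace[of "euclidean :: (real^2) topology"]
      convex_connected[OF convex_UNIV, where 'a = "real^2"] by simp
  ultimately show ?thesis
    by (simp add: smooth_surface_def chart_on_def inv_id)
qed

section \<open>Lengths of reversed and concatenated curves\<close>

lemma valid_path_differentiable_cofinite:
  assumes "valid_path \<gamma>"
  shows "\<exists>X. finite X \<and> (\<forall>t\<in>{0..1} - X. \<gamma> differentiable (at t))"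
  using assms unfolding valid_path_def piecewise_C1_differentiable_on_def C1_differentiable_on_eq
  by blast

context
  fixes s :: "'a::euclidean_space \<Rightarrow> 'a \<Rightarrow> real"
  assumes homogeneous: "\<And>u v k. s u (k *\<^sub>R v) = \<bar>k\<bar> * s u v"
begin

lemma has_integral_speed_reversepath:
  assumes \<gamma>: "valid_path \<gamma>"
    and L: "((\<lambda>t. s (\<gamma> t) (vector_derivative \<gamma> (at t))) has_integral L) {0..1}"
  shows "((\<lambda>t. s (reversepath \<gamma> t) (vector_derivative (reversepath \<gamma>) (at t))) has_integral L) {0..1}"
proof -
  obtain X where X: "finite X" "\<forall>t\<in>{0..1} - X. \<gamma> differentiable (at t)"
    using valid_path_differentiable_cofinite[OF \<gamma>] by blast
  have I: "((\<lambda>t. s (\<gamma> (1 - t)) (vector_derivative \<gamma> (at (1 - t)))) has_integral L) {0..1}"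
    using has_integral_affinity[of _ L 0 "1::real" "-1" 1] L by simp
  have VD: "vector_derivative (reversepath \<gamma>) (at t) = - vector_derivative \<gamma> (at (1 - t))"
    if "t \<in> {0..1} - (-) 1 ` X" for t
  proof -
    have "1 - t \<in> {0..1} - X" using that by (auto simp: image_iff)
    from X(2)[rule_format, OF this] have D: "(\<gamma> has_vector_derivative vector_derivative \<gamma> (at (1 - t))) (at (1 - t))"
      by (simp add: vector_derivative_works)
    have "(\<gamma> \<circ> (\<lambda>t. 1 - t) has_vector_derivative (-1) *\<^sub>R vector_derivative \<gamma> (at (1 - t))) (at t)"
      using D by (intro vector_diff_chain_at) (auto intro!: derivative_eq_intros)
    then show ?thesis
      by (intro vector_derivative_at) (simp add: reversepath_def o_def)
  qed
  have "s u (- v) = s u v" for u v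
    using homogeneous[of u "-1" v] by simp
  then show ?thesis
    by (intro has_integral_spike_finite[OF finite_imageI[OF X(1), of "(-) 1"] _ I])
      (simp add: VD, simp add: reversepath_def)
qed

lemma has_integral_speed_join:
  assumes \<gamma>: "valid_path \<gamma>1" "valid_path \<gamma>2"
    and L1: "((\<lambda>t. s (\<gamma>1 t) (vector_derivative \<gamma>1 (at t))) has_integral L1) {0..1}"
    and L2: "((\<lambda>t. s (\<gamma>2 t) (vector_derivative \<gamma>2 (at t))) has_integral L2) {0..1}"
  shows "((\<lambda>t. s ((\<gamma>1 +++ \<gamma>2) t) (vector_derivative (\<gamma>1 +++ \<gamma>2) (at t))) has_integral (L1 + L2)) {0..1}"
    (is "(?f has_integral _) _")
proof -
  obtain X1 where X1: "finite X1" "\<forall>t\<in>{0..1} - X1. \<gamma>1 differentiable (at t)"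
    using valid_path_differentiable_cofinite[OF \<gamma>(1)] by blast
  obtain X2 where X2: "finite X2" "\<forall>t\<in>{0..1} - X2. \<gamma>2 differentiable (at t)"
    using valid_path_differentiable_cofinite[OF \<gamma>(2)] by blast
  have I1: "((\<lambda>t. 2 * s (\<gamma>1 (2 * t)) (vector_derivative \<gamma>1 (at (2 * t)))) has_integral L1) {0..1/2}"
    using has_integral_cmul[OF has_integral_affinity'[of _ L1 0 "1::real" 2 0], of _ 2] L1 by simp
  have I2: "((\<lambda>t. 2 * s (\<gamma>2 (2 * t - 1)) (vector_derivative \<gamma>2 (at (2 * t - 1)))) has_integral L2) {1/2..1}"
    using has_integral_cmul[OF has_integral_affinity'[of _ L2 0 "1::real" 2 "-1"], of _ 2] L2 by simp
  have D1: "vector_derivative (\<gamma>1 +++ \<gamma>2) (at t) = 2 *\<^sub>R vector_derivative \<gamma>1 (at (2 * t))"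
    if t: "0 \<le> t" "2 * t < 1" "2 * t \<notin> X1" for t
  proof (rule vector_derivative_at[OF has_vector_derivative_transform_within])
    have "(\<gamma>1 has_vector_derivative vector_derivative \<gamma>1 (at (2 * t))) (at (2 * t))"
      using X1(2) t by (simp add: vector_derivative_works)
    then have "(\<gamma>1 \<circ> (\<lambda>t. 2 * t) has_vector_derivative 2 *\<^sub>R vector_derivative \<gamma>1 (at (2 * t))) (at t)"
      by (intro vector_diff_chain_at) (auto intro!: derivative_eq_intros)
    then show "((\<lambda>t. \<gamma>1 (2 * t)) has_vector_derivative 2 *\<^sub>R vector_derivative \<gamma>1 (at (2 * t))) (at t)"
      by (simp add: o_def)
    \<comment> \<open>Closer to \<open>t\<close> than this, the join stays on its first
      half.\<close>
    show "0 < \<bar>t - 1/2\<bar>" using t by auto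
  qed (use t in \<open>auto simp: joinpaths_def dist_real_def\<close>)
  have D2: "vector_derivative (\<gamma>1 +++ \<gamma>2) (at t) = 2 *\<^sub>R vector_derivative \<gamma>2 (at (2 * t - 1))"
    if t: "1 < 2 * t" "t \<le> 1" "2 * t - 1 \<notin> X2" for t
  proof (rule vector_derivative_at[OF has_vector_derivative_transform_within])
    have "(\<gamma>2 has_vector_derivative vector_derivative \<gamma>2 (at (2 * t - 1))) (at (2 * t - 1))"
      using X2(2) t by (simp add: vector_derivative_works)
    then have "(\<gamma>2 \<circ> (\<lambda>t. 2 * t - 1) has_vector_derivative 2 *\<^sub>R vector_derivative \<gamma>2 (at (2 * t - 1))) (at t)"
      by (intro vector_diff_chain_at) (auto intro!: derivative_eq_intros)
    then show "((\<lambda>t. \<gamma>2 (2 * t - 1)) has_vector_derivative 2 *\<^sub>R vector_derivative \<gamma>2 (at (2 * t - 1))) (at t)"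
      by (simp add: o_def)
    show "0 < \<bar>t - 1/2\<bar>" using t by auto
  qed (use t in \<open>auto simp: joinpaths_def dist_real_def\<close>)
  have v1: "(\<gamma>1 +++ \<gamma>2) t = \<gamma>1 (2 * t)" if "t * 2 \<le> 1" for t
    using that by (simp add: joinpaths_def)
  have v2: "(\<gamma>1 +++ \<gamma>2) t = \<gamma>2 (2 * t - 1)" if "1 < t * 2" for t
    using that by (simp add: joinpaths_def)
  have "(?f has_integral L1) {0..1/2}"
  proof (rule has_integral_spike_finite[OF _ _ I1])
    show "finite (insert (1/2) ((*) 2 -` X1))"
      using X1(1) by (auto intro!: finite_vimageI inj_onI)
  qed (auto simp: v1 D1 homogeneous)
  moreover have "(?f has_integral L2) {1/2..1}"
  proof (rule has_integral_spike_finite[OF _ _ I2])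
    show "finite (insert (1/2) ((\<lambda>t. 2 * t - 1) -` X2))"
      using X2(1) by (auto intro!: finite_vimageI inj_onI)
  qed (auto simp: v2 D2 homogeneous)
  ultimately show ?thesis by (intro has_integral_combine[of 0 "1/2" 1]) auto
qed

end

lemma hyp_norm_scaleR: "hyp_norm x (k *\<^sub>R v) = \<bar>k\<bar> * hyp_norm x v"
proof -
  have "hyp_metric x (k *\<^sub>R v) (k *\<^sub>R v) = k\<^sup>2 * hyp_metric x v v"
    by (simp add: hyp_metric_def power2_eq_square)
  then show ?thesis by (simp add: hyp_norm_def real_sqrt_mult)
qed

text \<open>The lower bound on the speed makes \<open>surface_dist\<close> at least \<open>k\<close>
  times the Euclidean distance, so Cauchy sequences converge in the plane. A bound for the speed on
  the unit ball around the limit turns this back into convergence for \<open>surface_dist\<close>.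
  The rest of the proof shows that \<open>surface_dist\<close> is a metric.\<close>

lemma mcomplete_surface_dist:
  fixes F :: "real^2 \<Rightarrow> real^3"
  assumes F: "has_partials F F1 F2" and ball: "\<And>u. norm (F u) < 1"
    and cont: "continuous_on UNIV F1" "continuous_on UNIV F2"
    and k: "k > 0" "\<And>u (v :: real^2). k * norm v \<le> hyp_norm (F u) (v $ 1 *\<^sub>R F1 u + v $ 2 *\<^sub>R F2 u)"
  shows "Metric_space.mcomplete UNIV (surface_dist euclidean {(UNIV, id)} F)"
proof -
  let ?d = "surface_dist euclidean {(UNIV, id)} F"
  let ?Ls = "\<lambda>p q. {L. \<exists>\<gamma>. piecewise_C1_curve euclidean {(UNIV, id)} \<gamma> \<and> \<gamma> 0 = p \<and> \<gamma> 1 = q \<and>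
               ((\<lambda>t. hyp_norm (F (\<gamma> t)) (vector_derivative (F \<circ> \<gamma>) (at t))) has_integral L) {0..1}}"
  let ?sp = "\<lambda>u (v :: real^2). hyp_norm (F u) (v $ 1 *\<^sub>R F1 u + v $ 2 *\<^sub>R F2 u)"
  have speed: "vector_derivative (F \<circ> \<gamma>) (at t) = \<gamma>' $ 1 *\<^sub>R F1 (\<gamma> t) + \<gamma>' $ 2 *\<^sub>R F2 (\<gamma> t)"
    if "(\<gamma> has_vector_derivative \<gamma>') (at t)" for \<gamma> t \<gamma>'
  proof -
    have "(F \<circ> \<gamma> has_vector_derivative (\<gamma>' $ 1 *\<^sub>R F1 (\<gamma> t) + \<gamma>' $ 2 *\<^sub>R F2 (\<gamma> t))) (at t)"
      using diff_chain_at[OF that[unfolded has_vector_derivative_def] has_partialsD[OF F, of "\<gamma> t"]]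
      unfolding has_vector_derivative_def
      by (rule has_derivative_eq_rhs) (simp add: fun_eq_iff scaleR_add_right)
    then show ?thesis by (rule vector_derivative_at)
  qed
  have nonneg: "hyp_norm x v \<ge> 0" for x v by (simp add: hyp_norm_def hyp_metric_def)
  have lower: "k * norm (q - p) \<le> L" if "L \<in> ?Ls p q" for L p q
  proof -
    from that obtain \<gamma> where \<gamma>: "piecewise_C1_curve euclidean {(UNIV, id)} \<gamma>" "\<gamma> 0 = p" "\<gamma> 1 = q"
      and L: "((\<lambda>t. hyp_norm (F (\<gamma> t)) (vector_derivative (F \<circ> \<gamma>) (at t))) has_integral L) {0..1}"
      by blast
    have "(id \<circ> \<gamma>) piecewise_C1_differentiable_on {0..1}"
      using \<gamma>(1)[unfolded piecewise_C1_curve_def] by auto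
    then have "\<gamma> piecewise_C1_differentiable_on {0..1}" by simp
    then obtain X where cont\<gamma>: "continuous_on {0..1} \<gamma>" and X: "finite X" "\<gamma> C1_differentiable_on ({0..1} - X)"
      unfolding piecewise_C1_differentiable_on_def by blast
    let ?\<gamma>' = "\<lambda>t. vector_derivative \<gamma> (at t)"
    have D: "(\<gamma> has_vector_derivative ?\<gamma>' t) (at t)" if "t \<in> {0..1} - X" for t
      using X(2) that by (auto simp: C1_differentiable_on_eq vector_derivative_works)
    have I: "(?\<gamma>' has_integral (\<gamma> 1 - \<gamma> 0)) {0..1}"
      by (rule fundamental_theorem_of_calculus_interior_strong[OF X(1)]) (use D cont\<gamma> in auto)
    \<comment> \<open>At break points \<open>vector_derivative\<close> has no controlled value.
      Setting both integrands to 0 there makes the comparison of norms hold at every point.\<close>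
    let ?g = "\<lambda>t. if t \<in> X then 0 else ?\<gamma>' t"
    let ?h = "\<lambda>t. if t \<in> X then 0 else hyp_norm (F (\<gamma> t)) (vector_derivative (F \<circ> \<gamma>) (at t))"
    have "(?g has_integral (\<gamma> 1 - \<gamma> 0)) {0..1}"
      by (rule has_integral_spike_finite[OF X(1) _ I]) auto
    then have 1: "((\<lambda>t. k *\<^sub>R ?g t) has_integral k *\<^sub>R (\<gamma> 1 - \<gamma> 0)) {0..1}"
      by (rule has_integral_cmul)
    have 2: "(?h has_integral L) {0..1}"
      by (rule has_integral_spike_finite[OF X(1) _ L]) auto
    have "norm (k *\<^sub>R (\<gamma> 1 - \<gamma> 0)) \<le> L \<bullet> 1"
    proof (rule has_integral_norm_bound_integral_component[OF 1 2])
      fix t :: real assume t: "t \<in> {0..1}"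
      show "norm (k *\<^sub>R ?g t) \<le> ?h t \<bullet> 1"
        using t k(1) k(2)[of "?\<gamma>' t" "\<gamma> t"] speed[OF D, of t] by (cases "t \<in> X") auto
    qed
    then show ?thesis using k(1) \<gamma>(2,3) by simp
  qed
  have upper: "?d p q \<le> K * norm (q - p)" "?Ls p q \<noteq> {}"
    if K: "\<And>u v. u \<in> closed_segment p q \<Longrightarrow> ?sp u v \<le> K * norm v" for p q K
  proof -
    define \<gamma> where "\<gamma> = (\<lambda>t::real. p + t *\<^sub>R (q - p))"
    have D: "(\<gamma> has_vector_derivative (q - p)) (at t)" for t
      unfolding \<gamma>_def by (auto intro!: derivative_eq_intros)
    have cont\<gamma>: "continuous_on A \<gamma>" for A unfolding \<gamma>_def by (intro continuous_intros)
    have "\<gamma> C1_differentiable_on A" for A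
      unfolding C1_differentiable_on_def using D by (intro exI[of _ "\<lambda>_. q - p"]) auto
    then have "piecewise_C1_curve euclidean {(UNIV, id)} \<gamma>"
      unfolding piecewise_C1_curve_def
      using cont\<gamma> C1_differentiable_imp_piecewise by auto
    moreover have "\<gamma> 0 = p" "\<gamma> 1 = q" by (simp_all add: \<gamma>_def)
    moreover have "(\<lambda>t. hyp_norm (F (\<gamma> t)) (vector_derivative (F \<circ> \<gamma>) (at t))) integrable_on {0..1}"
    proof (rule integrable_continuous_real)
      have "continuous_on {0..1} (\<lambda>t. F (\<gamma> t))"
        using has_partials_isCont[OF F]
        by (intro continuous_on_compose2[of UNIV F, OF _ cont\<gamma>]) (simp_all add: continuous_on_eq_continuous_at)
      moreover have "continuous_on {0..1} (\<lambda>t. F1 (\<gamma> t))" "continuous_on {0..1} (\<lambda>t. F2 (\<gamma> t))"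
        using cont by (auto intro: continuous_on_compose2[OF _ cont\<gamma>])
      moreover have "1 - (norm (F (\<gamma> t)))\<^sup>2 \<noteq> 0" for t
        using ball[of "\<gamma> t"] abs_square_less_1[of "norm (F (\<gamma> t))"] by simp
      ultimately have "continuous_on {0..1} (\<lambda>t. ?sp (\<gamma> t) (q - p))"
        unfolding hyp_norm_def hyp_metric_def by (intro continuous_intros ballI)
      then show "continuous_on {0..1} (\<lambda>t. hyp_norm (F (\<gamma> t)) (vector_derivative (F \<circ> \<gamma>) (at t)))"
        by (simp add: speed[OF D])
    qed
    then obtain L where L: "((\<lambda>t. hyp_norm (F (\<gamma> t)) (vector_derivative (F \<circ> \<gamma>) (at t))) has_integral L) {0..1}"
      by blast
    ultimately have "L \<in> ?Ls p q" by blast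
    then show "?Ls p q \<noteq> {}" by blast
    have "?d p q \<le> L"
      unfolding surface_dist_def
      using \<open>L \<in> ?Ls p q\<close> lower by (intro cInf_lower bdd_belowI[of _ "k * norm (q - p)"]) auto
    also have "L \<le> K * norm (q - p)"
    proof (rule has_integral_le[OF L])
      show "((\<lambda>t. K * norm (q - p)) has_integral K * norm (q - p)) {0..1::real}"
        using has_integral_const_real[of "K * norm (q - p)" 0 1] by simp
      fix t :: real assume "t \<in> {0..1}"
      then have seg: "\<gamma> t \<in> closed_segment p q"
        unfolding \<gamma>_def in_segment by (auto simp: algebra_simps intro!: exI[of _ t])
      then show "hyp_norm (F (\<gamma> t)) (vector_derivative (F \<circ> \<gamma>) (at t)) \<le> K * norm (q - p)"
        using K[OF seg, of "q - p"] by (simp add: speed[OF D])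
    qed
    finally show "?d p q \<le> K * norm (q - p)" .
  qed
  have nonneg_d: "?d p q \<ge> k * norm (q - p)" if "?Ls p q \<noteq> {}" for p q
    unfolding surface_dist_def using lower that by (intro cInf_greatest) auto
  have bound: "\<exists>K. \<forall>u\<in>cball p 1. \<forall>v. ?sp u v \<le> K * norm v" for p
  proof -
    let ?lam = "\<lambda>u. 2 / (1 - (norm (F u))\<^sup>2)"
    let ?f = "\<lambda>u. ?lam u * (norm (F1 u) + norm (F2 u))"
    have nz: "1 - (norm (F u))\<^sup>2 > 0" for u
      using ball[of u] abs_square_less_1[of "norm (F u)"] by simp
    have "continuous_on (cball p 1) ?f"
    proof (intro continuous_intros continuous_on_subset[OF cont(1)] continuous_on_subset[OF cont(2)] ballI)
      show "continuous_on (cball p 1) F"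
        using has_partials_isCont[OF F] by (simp add: continuous_at_imp_continuous_on)
      show "1 - (norm (F u))\<^sup>2 \<noteq> 0" for u using nz[of u] by simp
    qed auto
    then have "bounded (?f ` cball p 1)"
      by (intro compact_imp_bounded compact_continuous_image) auto
    then obtain K where K: "\<And>u. u \<in> cball p 1 \<Longrightarrow> norm (?f u) \<le> K"
      unfolding bounded_iff by blast
    have "?sp u v \<le> K * norm v" if u: "u \<in> cball p 1" for u v
    proof -
      have "?sp u v = ?lam u * norm (v $ 1 *\<^sub>R F1 u + v $ 2 *\<^sub>R F2 u)"
        using nz[of u] by (simp add: hyp_norm_def hyp_metric_def real_sqrt_mult norm_eq_sqrt_inner)
      also have "\<dots> \<le> ?lam u * (norm v * norm (F1 u) + norm v * norm (F2 u))"
      proof (intro mult_left_mono)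
        have "norm (v $ 1 *\<^sub>R F1 u + v $ 2 *\<^sub>R F2 u) \<le> \<bar>v $ 1\<bar> * norm (F1 u) + \<bar>v $ 2\<bar> * norm (F2 u)"
          using norm_triangle_ineq[of "v $ 1 *\<^sub>R F1 u" "v $ 2 *\<^sub>R F2 u"] by simp
        also have "\<dots> \<le> norm v * norm (F1 u) + norm v * norm (F2 u)"
          by (intro add_mono mult_right_mono component_le_norm_cart) auto
        finally show "norm (v $ 1 *\<^sub>R F1 u + v $ 2 *\<^sub>R F2 u) \<le> norm v * norm (F1 u) + norm v * norm (F2 u)" .
      qed (use nz[of u] in auto)
      also have "\<dots> = ?f u * norm v" by (simp add: algebra_simps)
      also have "\<dots> \<le> K * norm v" using order_trans[OF abs_ge_self K[OF u, unfolded real_norm_def]] by (rule mult_right_mono) simp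
      finally show ?thesis .
    qed
    then show ?thesis by blast
  qed
  \<comment> \<open>Nonemptiness is essential because the infimum of the empty set carries no
    information. Finitely many unit balls cover the segment, and the sum of their constants bounds
    the speed along it.\<close>
  have ne: "?Ls p q \<noteq> {}" for p q
  proof -
    let ?Sg = "closed_segment p q"
    have "\<forall>p. \<exists>K. \<forall>u\<in>cball p 1. \<forall>v. ?sp u v \<le> K * norm v" using bound by blast
    from choice[OF this] obtain Kf where "\<forall>p. \<forall>u\<in>cball p 1. \<forall>v. ?sp u v \<le> Kf p * norm v" by blast
    then have Kf: "?sp u v \<le> Kf p * norm v" if "u \<in> cball p 1" for p u v
      using that by blast
    have cover: "?Sg \<subseteq> (\<Union>p\<in>?Sg. ball p 1)" by auto
    obtain T where T: "finite T" "T \<subseteq> ?Sg" "?Sg \<subseteq> (\<Union>p\<in>T. ball p 1)"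
      by (rule compactE_image[OF compact_segment _ cover]) auto
    have "?sp u v \<le> (\<Sum>p\<in>T. \<bar>Kf p\<bar>) * norm v" if u: "u \<in> ?Sg" for u v
    proof -
      from u T(3) obtain p where p: "p \<in> T" "u \<in> ball p 1" by blast
      have "?sp u v \<le> Kf p * norm v" using Kf[of u p v] p(2) by auto
      also have "Kf p \<le> (\<Sum>p\<in>T. \<bar>Kf p\<bar>)"
        using member_le_sum[OF p(1), of "\<lambda>p. \<bar>Kf p\<bar>"] T(1) by auto
      finally show ?thesis by (simp add: mult_right_mono)
    qed
    then show ?thesis by (rule upper(2))
  qed
  \<comment> \<open>Lengths are rewritten as integrals of a homogeneous function of position and
    velocity in the plane, the form in which curves can be reversed and joined.\<close>
  have Ls_iff: "L \<in> ?Ls p q \<longleftrightarrow> (\<exists>\<gamma>. valid_path \<gamma> \<and> pathstart \<gamma> = p \<and> pathfinish \<gamma> = q \<and>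
      ((\<lambda>t. ?sp (\<gamma> t) (vector_derivative \<gamma> (at t))) has_integral L) {0..1})" for L p q
  proof -
    have curve: "piecewise_C1_curve euclidean {(UNIV, id)} \<gamma> \<longleftrightarrow> valid_path \<gamma>" for \<gamma>
    proof
      assume "piecewise_C1_curve euclidean {(UNIV, id)} \<gamma>"
      then show "valid_path \<gamma>" by (auto simp: piecewise_C1_curve_def valid_path_def)
    next
      assume "valid_path \<gamma>"
      then show "piecewise_C1_curve euclidean {(UNIV, id)} \<gamma>"
        using piecewise_C1_differentiable_on_subset[of \<gamma> "{0..1}"]
          valid_path_imp_path[of \<gamma>]
        by (simp add: piecewise_C1_curve_def valid_path_def path_def)
    qed
    have "((\<lambda>t. hyp_norm (F (\<gamma> t)) (vector_derivative (F \<circ> \<gamma>) (at t))) has_integral L) {0..1} \<longleftrightarrow>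
      ((\<lambda>t. ?sp (\<gamma> t) (vector_derivative \<gamma> (at t))) has_integral L) {0..1}" if vp: "valid_path \<gamma>" for \<gamma>
    proof -
      obtain X where X: "finite X" "\<forall>t\<in>{0..1} - X. \<gamma> differentiable (at t)"
        using valid_path_differentiable_cofinite[OF vp] by blast
      show ?thesis
      proof (rule has_integral_spike_finite_eq[OF X(1)])
        fix t assume "t \<in> {0..1} - X"
        then have "(\<gamma> has_vector_derivative vector_derivative \<gamma> (at t)) (at t)"
          using X(2) by (simp add: vector_derivative_works)
        from speed[OF this] show "?sp (\<gamma> t) (vector_derivative \<gamma> (at t)) =
            hyp_norm (F (\<gamma> t)) (vector_derivative (F \<circ> \<gamma>) (at t))" by simp
      qed
    qed
    then show ?thesis by (auto simp: curve pathstart_def pathfinish_def)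
  qed
  have hom: "?sp u (c *\<^sub>R v) = \<bar>c\<bar> * ?sp u v" for u v c
    using hyp_norm_scaleR[of "F u" c "v $ 1 *\<^sub>R F1 u + v $ 2 *\<^sub>R F2 u"] by (simp add: scaleR_add_right)
  have bdd: "bdd_below (?Ls p q)" for p q
    using lower by (intro bdd_belowI[of _ "k * norm (q - p)"])
  interpret Metric_space UNIV ?d
  proof
    fix p q r :: "real^2"
    show "0 \<le> ?d p q" using nonneg_d[OF ne, where p = p and q = q] k(1) by (intro order_trans[OF _ nonneg_d[OF ne]]) simp
    have le: "?d p q \<le> ?d q p" for p q
    proof -
      have "?Ls q p \<subseteq> ?Ls p q"
      proof
        fix L assume "L \<in> ?Ls q p"
        then obtain \<gamma> where "valid_path \<gamma>" "pathstart \<gamma> = q" "pathfinish \<gamma> = p"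
          "((\<lambda>t. ?sp (\<gamma> t) (vector_derivative \<gamma> (at t))) has_integral L) {0..1}"
          unfolding Ls_iff by blast
        then show "L \<in> ?Ls p q"
          unfolding Ls_iff
          by (intro exI[of _ "reversepath \<gamma>"] conjI valid_path_imp_reverse
              has_integral_speed_reversepath[where s = ?sp, OF hom]) auto
      qed
      then show ?thesis unfolding surface_dist_def by (intro cInf_superset_mono ne bdd)
    qed
    show "?d p q = ?d q p" using le by (intro antisym)
    show "?d p q = 0 \<longleftrightarrow> p = q"
    proof
      assume "?d p q = 0"
      then have "k * norm (q - p) \<le> 0" using nonneg_d[OF ne, where p = p and q = q] by simp
      then show "p = q" using k(1) by (simp add: mult_le_0_iff)
    next
      assume "p = q"
      moreover obtain K where "\<And>u v. u \<in> cball p 1 \<Longrightarrow> ?sp u v \<le> K * norm v" using bound by blast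
      ultimately have "?d p q \<le> K * norm (q - p)" by (intro upper(1)) auto
      then show "?d p q = 0" using nonneg_d[OF ne, where p = p and q = q] \<open>p = q\<close> by simp
    qed
    \<comment> \<open>The infimum is taken over one leg at a time, with the length of the other leg
      held fixed.\<close>
    have "?d p r - b \<le> a" if "a \<in> ?Ls p q" "b \<in> ?Ls q r" for a b
    proof -
      from that obtain \<gamma>1 \<gamma>2 where "valid_path \<gamma>1" "pathstart \<gamma>1 = p" "pathfinish \<gamma>1 = q"
          "((\<lambda>t. ?sp (\<gamma>1 t) (vector_derivative \<gamma>1 (at t))) has_integral a) {0..1}"
          "valid_path \<gamma>2" "pathstart \<gamma>2 = q" "pathfinish \<gamma>2 = r"
          "((\<lambda>t. ?sp (\<gamma>2 t) (vector_derivative \<gamma>2 (at t))) has_integral b) {0..1}"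
        unfolding Ls_iff by blast
      then have "a + b \<in> ?Ls p r"
        unfolding Ls_iff
        by (intro exI[of _ "\<gamma>1 +++ \<gamma>2"] conjI valid_path_join
            has_integral_speed_join[where s = ?sp, OF hom]) auto
      then have "?d p r \<le> a + b" unfolding surface_dist_def by (intro cInf_lower bdd)
      then show ?thesis by simp
    qed
    then have "?d p r - b \<le> ?d p q" if "b \<in> ?Ls q r" for b
      unfolding surface_dist_def[of _ _ _ p q] using that by (intro cInf_greatest ne)
    then have "?d p r - ?d p q \<le> b" if "b \<in> ?Ls q r" for b
      using that by (simp add: algebra_simps)
    then have "?d p r - ?d p q \<le> ?d q r"
      unfolding surface_dist_def[of _ _ _ q r] by (intro cInf_greatest ne)
    then show "?d p r \<le> ?d p q + ?d q r" by simp
  qed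
  show ?thesis
    unfolding mcomplete_def
  proof (intro allI impI)
    fix \<sigma> :: "nat \<Rightarrow> real^2"
    assume "MCauchy \<sigma>"
    then have cau: "\<And>\<epsilon>. \<epsilon> > 0 \<Longrightarrow> \<exists>N. \<forall>n n'. N \<le> n \<longrightarrow> N \<le> n' \<longrightarrow> ?d (\<sigma> n) (\<sigma> n') < \<epsilon>"
      unfolding MCauchy_def by blast
    have "Cauchy \<sigma>"
      unfolding Cauchy_def
    proof (intro allI impI)
      fix e :: real assume "e > 0"
      then obtain N where N: "\<And>n n'. N \<le> n \<Longrightarrow> N \<le> n' \<Longrightarrow> ?d (\<sigma> n) (\<sigma> n') < k * e"
        using cau[of "k * e"] k(1) by auto
      have "dist (\<sigma> m) (\<sigma> n) < e" if "m \<ge> N" "n \<ge> N" for m n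
      proof -
        have "k * norm (\<sigma> n - \<sigma> m) < k * e"
          using nonneg_d[OF ne, where p = "\<sigma> m" and q = "\<sigma> n"] N[OF that] by simp
        then show ?thesis using k(1) by (simp add: dist_norm norm_minus_commute)
      qed
      then show "\<exists>M. \<forall>m\<ge>M. \<forall>n\<ge>M. dist (\<sigma> m) (\<sigma> n) < e" by blast
    qed
    then obtain x where x: "\<sigma> \<longlonglongrightarrow> x" using Cauchy_convergent_iff convergent_def by blast
    obtain K where K: "\<And>u v. u \<in> cball x 1 \<Longrightarrow> ?sp u v \<le> K * norm v" using bound by blast
    have "eventually (\<lambda>n. \<sigma> n \<in> cball x 1) sequentially"
      using tendstoD[OF x, of 1] by (auto elim!: eventually_mono simp: dist_commute)
    then have ev: "eventually (\<lambda>n. ?d x (\<sigma> n) \<le> K * norm (\<sigma> n - x)) sequentially"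
    proof (rule eventually_mono)
      fix n assume "\<sigma> n \<in> cball x 1"
      then have "closed_segment x (\<sigma> n) \<subseteq> cball x 1"
        by (intro closed_segment_subset) auto
      then show "?d x (\<sigma> n) \<le> K * norm (\<sigma> n - x)" using upper(1) K by blast
    qed
    have to0: "(\<lambda>n. K * norm (\<sigma> n - x)) \<longlonglongrightarrow> K * norm (x - x)"
      by (intro tendsto_intros x)
    have "limitin mtopology \<sigma> x sequentially"
      unfolding limitin_metric
    proof (intro conjI allI impI)
      fix e :: real assume "e > 0"
      then have "eventually (\<lambda>n. K * norm (\<sigma> n - x) < e) sequentially"
        using order_tendstoD(2)[OF to0] by simp
      with ev show "eventually (\<lambda>n. \<sigma> n \<in> UNIV \<and> ?d (\<sigma> n) x < e) sequentially"
        by eventually_elim (simp add: commute)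
    qed simp
    then show "\<exists>x. limitin mtopology \<sigma> x sequentially" ..
  qed
qed

section \<open>Total angle of the generating curve\<close>

text \<open>
  Angular velocity \<open>d\<psi>/d\<theta>\<close> of the generating curve in terms of \<open>\<theta> = arctan (sinh p)\<close>. In this
  variable the whole curve corresponds to a bounded interval and the velocity is continuous up to
  its end points.
\<close>

definition ang_vel :: "real \<Rightarrow> real \<Rightarrow> real \<Rightarrow> real" where
  "ang_vel a c \<theta> = (let y = cos \<theta> / sqrt ((cos \<theta>)\<^sup>2 + 4 * c\<^sup>2)
     in sqrt (((1 + a\<^sup>2) * y + (1 - a\<^sup>2) * y\<^sup>2) / 2))"

definition total_angle :: "real \<Rightarrow> real \<Rightarrow> real" where
  "total_angle a c = integral {- (pi/2)..pi/2} (ang_vel a c)"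

lemma continuous_on_ang_vel:
  assumes "\<And>c. c \<in> I \<Longrightarrow> c > 0"
  shows "continuous_on (I \<times> J) (\<lambda>(c, \<theta>). ang_vel a c \<theta>)"
proof -
  have "sqrt ((cos \<theta>)\<^sup>2 + 4 * c\<^sup>2) \<noteq> 0" if "c \<in> I" for c \<theta>
    using assms[OF that] by (simp add: sum_power2_eq_zero_iff add_nonneg_eq_0_iff)
  then show ?thesis
    unfolding ang_vel_def Let_def case_prod_beta
    by (intro continuous_intros) auto
qed

lemma continuous_on_ang_vel':
  assumes "c > 0"
  shows "continuous_on J (ang_vel a c)"
proof -
  have "continuous_on J (\<lambda>\<theta>. case (c, \<theta>) of (c, \<theta>) \<Rightarrow> ang_vel a c \<theta>)"
    by (rule continuous_on_compose2[OF continuous_on_ang_vel[of "{c}" J a]])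
      (use assms in \<open>auto intro!: continuous_intros\<close>)
  then show ?thesis by simp
qed

lemma continuous_on_total_angle: "continuous_on {1..b} (total_angle a)"
  unfolding total_angle_def
  using integral_continuous_on_param[of "{1..b}" "- (pi/2)" "pi/2" "ang_vel a"]
    continuous_on_ang_vel[of "{1..b}" "{- (pi/2)..pi/2}" a] by simp

text \<open>With this \<open>c\<close>, the quantity \<open>y\<close> in \<open>ang_vel\<close> is
  at most \<open>1 / (2 * c) = 1 / (1 + a\<^sup>2)\<close>. The integrand is then at most 1 on an
  interval of length pi.\<close>

lemma total_angle_le:
  assumes "a > 0" "c = (1 + a\<^sup>2) / 2"
  shows "total_angle a c \<le> pi"
proof -
  have c: "c > 0" unfolding assms(2) by (simp add: add_pos_nonneg)
  have "ang_vel a c \<theta> \<le> 1" if "\<theta> \<in> {- (pi/2)..pi/2}" for \<theta>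
  proof -
    let ?d = "sqrt ((cos \<theta>)\<^sup>2 + 4 * c\<^sup>2)" and ?y = "cos \<theta> / sqrt ((cos \<theta>)\<^sup>2 + 4 * c\<^sup>2)"
    have cos0: "cos \<theta> \<ge> 0" using that by (intro cos_ge_zero) auto
    have d: "?d \<ge> 2 * c" "?d \<ge> cos \<theta>"
      using c cos0 by (intro real_le_rsqrt; simp add: power_mult_distrib)+
    have "cos \<theta> \<le> 1" by simp
    have y: "0 \<le> ?y"
      using cos0 by (intro divide_nonneg_nonneg) auto
    have y1: "?y \<le> 1"
      using d c by (intro divide_le_eq_1_pos[THEN iffD2]) linarith+
    have yc: "?y \<le> 1 / (2 * c)"
      using cos0 d c by (intro frac_le) auto
    have "(1 - a\<^sup>2) * ?y\<^sup>2 \<le> (1 + a\<^sup>2) * ?y"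
    proof -
      have "(1 - a\<^sup>2) * ?y\<^sup>2 \<le> (1 + a\<^sup>2) * ?y\<^sup>2" by (intro mult_right_mono) auto
      also have "\<dots> \<le> (1 + a\<^sup>2) * ?y"
        using y y1 power_decreasing[of 1 2 ?y] by (intro mult_left_mono) auto
      finally show ?thesis .
    qed
    moreover have "(1 + a\<^sup>2) * ?y \<le> 1"
    proof -
      have "(1 + a\<^sup>2) * ?y \<le> (1 + a\<^sup>2) * (1 / (2 * c))" using yc by (intro mult_left_mono) auto
      also have "\<dots> = 1" using c assms(2) by simp
      finally show ?thesis .
    qed
    ultimately have "((1 + a\<^sup>2) * ?y + (1 - a\<^sup>2) * ?y\<^sup>2) / 2 \<le> 1" by simp
    then show ?thesis unfolding ang_vel_def Let_def by simp
  qed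
  then have "total_angle a c \<le> integral {- (pi/2)..pi/2} (\<lambda>_. 1)"
    unfolding total_angle_def
    by (intro integral_le integrable_continuous_real continuous_on_ang_vel' c) auto
  then show ?thesis by simp
qed

text \<open>The radicand of \<open>ang_vel\<close> is at least
  \<open>a\<^sup>2 * y * (1 - y) / 2\<close>. For \<open>c = 1\<close> one has
  \<open>cos \<theta> / 3 \<le> y \<le> 1 / 2\<close>, so the radicand dominates the square of
  \<open>a / 4 * cos \<theta>\<close>, a function whose integral is \<open>a / 2\<close>.\<close>

lemma total_angle_ge:
  assumes "a > 0"
  shows "total_angle a 1 \<ge> a / 2"
proof -
  have "ang_vel a 1 \<theta> \<ge> a / 4 * cos \<theta>" if "\<theta> \<in> {- (pi/2)..pi/2}" for \<theta>
  proof -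
    let ?y = "cos \<theta> / sqrt ((cos \<theta>)\<^sup>2 + 4)"
    have cos: "cos \<theta> \<ge> 0" "cos \<theta> \<le> 1" using that by (auto intro!: cos_ge_zero)
    have "(cos \<theta>)\<^sup>2 \<le> 1" using cos by (simp add: power_le_one)
    then have "sqrt ((cos \<theta>)\<^sup>2 + 4) \<le> 3" "sqrt ((cos \<theta>)\<^sup>2 + 4) \<ge> 2"
      by (intro real_le_lsqrt real_le_rsqrt; simp)+
    then have y: "?y \<ge> cos \<theta> / 3" "?y \<le> 1 / 2" "?y \<ge> 0"
      using cos by (intro divide_left_mono frac_le divide_nonneg_nonneg mult_pos_pos; linarith)+
    have "(a / 4 * cos \<theta>)\<^sup>2 = a\<^sup>2 * (cos \<theta>)\<^sup>2 / 16" by (simp add: power2_eq_square)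
    also have "\<dots> \<le> a\<^sup>2 * (cos \<theta> / 3 * (1 / 2)) / 2"
    proof -
      have "(cos \<theta>)\<^sup>2 \<le> cos \<theta>" using cos by (simp add: power2_eq_square mult_left_le)
      then have "(cos \<theta>)\<^sup>2 / 16 \<le> cos \<theta> / 12" using cos by simp
      then have "a\<^sup>2 * ((cos \<theta>)\<^sup>2 / 16) \<le> a\<^sup>2 * (cos \<theta> / 12)" by (rule mult_left_mono) simp
      then show ?thesis by simp
    qed
    also have "\<dots> \<le> a\<^sup>2 * (?y * (1 - ?y)) / 2"
      using y cos by (intro divide_right_mono mult_left_mono mult_mono) auto
    also have "\<dots> \<le> ((1 + a\<^sup>2) * ?y + (1 - a\<^sup>2) * ?y\<^sup>2) / 2"
    proof -
      have "((1 + a\<^sup>2) * ?y + (1 - a\<^sup>2) * ?y\<^sup>2) - a\<^sup>2 * (?y * (1 - ?y)) = ?y + ?y\<^sup>2"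
        by algebra
      moreover have "?y + ?y\<^sup>2 \<ge> 0" using y(3) by simp
      ultimately show ?thesis by simp
    qed
    finally show ?thesis unfolding ang_vel_def Let_def by (intro real_le_rsqrt) simp
  qed
  moreover have cosI: "((\<lambda>\<theta>. a / 4 * cos \<theta>) has_integral a / 4 * 2) {- (pi/2)..pi/2}"
  proof -
    have "((\<lambda>\<theta>. cos \<theta>) has_integral (sin (pi/2) - sin (- (pi/2)))) {- (pi/2)..pi/2}"
      by (rule fundamental_theorem_of_calculus)
        (auto intro!: derivative_eq_intros simp flip: has_real_derivative_iff_has_vector_derivative)
    then show ?thesis by (intro has_integral_mult_right) simp
  qed
  ultimately have "integral {- (pi/2)..pi/2} (\<lambda>\<theta>. a / 4 * cos \<theta>) \<le> total_angle a 1"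
    unfolding total_angle_def
    by (intro integral_le integrable_continuous_real continuous_on_ang_vel' continuous_intros) auto
  then show ?thesis using integral_unique[OF cosI] by simp
qed

text \<open>The choice of \<open>a\<close> makes the lower bound \<open>a / 2\<close> at
  \<open>c = 1\<close> equal to \<open>pi * (2 * M + 1)\<close>, above all target values, while the
  upper bound pi at the other end is the smallest target.\<close>

lemma total_angle_values:
  fixes M :: nat
  assumes a: "a = 2 * pi * (2 * real M + 1)" and k: "k < M"
  shows "\<exists>c\<ge>1. total_angle a c = pi * (2 * real k + 1)"
proof -
  have a1: "a \<ge> 1"
  proof -
    have "1 \<le> 2 * pi * 1" using pi_gt3 by simp
    also have "\<dots> \<le> 2 * pi * (2 * real M + 1)" by (intro mult_left_mono) auto
    finally show ?thesis using a by (simp add: add.commute)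
  qed
  have "\<exists>c\<ge>1. c \<le> (1 + a\<^sup>2) / 2 \<and> total_angle a c = pi * (2 * real k + 1)"
  proof (rule IVT2')
    have "pi * 1 \<le> pi * (2 * real k + 1)" by (intro mult_left_mono) auto
    then show "total_angle a ((1 + a\<^sup>2) / 2) \<le> pi * (2 * real k + 1)"
      using total_angle_le[of a "(1 + a\<^sup>2) / 2"] a1 by linarith
    have "pi * (2 * real k + 1) \<le> pi * (2 * real M + 1)" using k by (intro mult_left_mono) auto
    also have "\<dots> = a / 2" using a by simp
    finally show "pi * (2 * real k + 1) \<le> total_angle a 1"
      using total_angle_ge[of a] a1 by simp
    show "1 \<le> (1 + a\<^sup>2) / 2" using a1 by (simp add: one_le_power)
  qed (rule continuous_on_total_angle)
  then show ?thesis by blast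
qed

section \<open>Screw-invariant minimal surfaces\<close>

text \<open>The minimality equation in Minkowski space, split into components: the coefficients of
  the two hyperbolic functions of \<open>t\<close>, then the radial and the angular direction.
  Reciprocals are variables bound by \<open>inv\<close>, which leaves purely polynomial claims.
  \<open>W\<close> stands for the squared length of the Killing field, and \<open>P\<close> states
  that the generating curve moves with speed \<open>S C / q\<close> times that length.\<close>

lemma screw_minimality_identities:
  fixes a C S R P W q ci si qi Wi :: real
  assumes inv: "C * ci = 1" "S * si = 1" "q * qi = 1" "W * Wi = 1"
    and rel: "C\<^sup>2 = S\<^sup>2 + 1" "q = C\<^sup>2 + S\<^sup>2" "W = C\<^sup>2 + a\<^sup>2 * S\<^sup>2"
    and P: "P\<^sup>2 = W * (qi\<^sup>2 - R\<^sup>2 * ci\<^sup>2 * si\<^sup>2)"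
    and second: "R2 = S * C * (1 - 4 * R\<^sup>2) * qi"
      "P2 = P * R * ((1 + a\<^sup>2) * S * C * Wi - 4 * S * C * qi - q * si * ci)"
    and efg: "e = R\<^sup>2 + S\<^sup>2 * P\<^sup>2" "f = a * S\<^sup>2 * P" "g = W"
    and AB: "A = R * (W * si * ci - 4 * S * C * W * qi + (1 + a\<^sup>2) * S * C - 2 * a\<^sup>2 * S * ci)"
      "B = - 2 * f * S * R * ci"
  shows "g * (C * R\<^sup>2 + S * R2) + e * C = A * (S * R) + 2 * (e * g - f\<^sup>2) * C"
    "- 2 * f * (S * R) = B * C"
    "g * (S * R\<^sup>2 + C * R2 - S * P\<^sup>2) + 2 * f * (a * S * P) - e * (a\<^sup>2 * S) =
       A * (C * R) + 2 * (e * g - f\<^sup>2) * S"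
    "g * (2 * C * R * P + S * P2) - 2 * f * (a * C * R) = A * (S * P) + B * (a * S)"
proof -
  have sc: "S\<^sup>2 * si\<^sup>2 = 1" "C\<^sup>2 * ci\<^sup>2 = 1" using inv by algebra+
  have S2P: "S\<^sup>2 * P\<^sup>2 = W * (S\<^sup>2 * qi\<^sup>2 - R\<^sup>2 * ci\<^sup>2)" using P sc by algebra
  \<comment> \<open>The squared area density is the squared speed of the generating curve in the
    metric on the orbit space; that speed is prescribed by the relation for
    \<open>P\<close>.\<close>
  have D: "e * g - f\<^sup>2 = W * S\<^sup>2 * C\<^sup>2 * qi\<^sup>2"
    using efg rel(3) S2P sc by algebra
  show "- 2 * f * (S * R) = B * C" using AB(2) inv(1) by algebra
  show "g * (C * R\<^sup>2 + S * R2) + e * C = A * (S * R) + 2 * (e * g - f\<^sup>2) * C"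
  proof -
    have "g * (C * R\<^sup>2 + S * R2) + e * C =
        W * (C * R\<^sup>2 + S * (S * C * (1 - 4 * R\<^sup>2) * qi)) + (R\<^sup>2 + W * (S\<^sup>2 * qi\<^sup>2 - R\<^sup>2 * ci\<^sup>2)) * C"
      using efg S2P second by simp
    moreover have "A * (S * R) = R\<^sup>2 * (W * ci - 4 * S\<^sup>2 * C * W * qi + (1 + a\<^sup>2) * S\<^sup>2 * C - 2 * a\<^sup>2 * S\<^sup>2 * ci)"
      using AB(1) inv(2) by algebra
    moreover have "C * ci\<^sup>2 = ci" using inv(1) by algebra
    \<comment> \<open>Both sides are polynomials in \<open>R\<close>. This relation matches the
      coefficients of \<open>R\<^sup>2\<close>, the next one those free of \<open>R\<close>; the
      third conclusion is split in the same way.\<close>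
    moreover have "W * C + C - 2 * W * ci = (1 + a\<^sup>2) * S\<^sup>2 * C - 2 * a\<^sup>2 * S\<^sup>2 * ci"
      using inv(1) rel by algebra
    moreover have "S\<^sup>2 * C * qi + S\<^sup>2 * qi\<^sup>2 * C = 2 * S\<^sup>2 * C\<^sup>2 * qi\<^sup>2 * C"
      using inv(3) rel(1,2) by algebra
    ultimately show ?thesis unfolding D by algebra
  qed
  show "g * (S * R\<^sup>2 + C * R2 - S * P\<^sup>2) + 2 * f * (a * S * P) - e * (a\<^sup>2 * S) =
       A * (C * R) + 2 * (e * g - f\<^sup>2) * S"
  proof -
    have SP: "S * P\<^sup>2 = W * (S * qi\<^sup>2 - R\<^sup>2 * ci\<^sup>2 * si)" using P inv(2) by algebra
    have AC: "A * (C * R) = R\<^sup>2 * (W * si - 4 * S * C\<^sup>2 * W * qi + (1 + a\<^sup>2) * S * C\<^sup>2 - 2 * a\<^sup>2 * S)"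
      using AB(1) inv(1) by algebra
    have "2 * f * (a * S * P) = 2 * a\<^sup>2 * S * (S\<^sup>2 * P\<^sup>2)" using efg by algebra
    then have "2 * f * (a * S * P) - e * (a\<^sup>2 * S) = a\<^sup>2 * S * (S\<^sup>2 * P\<^sup>2 - R\<^sup>2)" using efg by algebra
    moreover have "g * (S * R\<^sup>2 + C * R2 - S * P\<^sup>2) =
        W * (S * R\<^sup>2 + C * (S * C * (1 - 4 * R\<^sup>2) * qi) - W * (S * qi\<^sup>2 - R\<^sup>2 * ci\<^sup>2 * si))"
      unfolding efg(3) second SP by simp
    moreover have "W * S + W * W * ci\<^sup>2 * si - a\<^sup>2 * S * W * ci\<^sup>2 - a\<^sup>2 * S =
        W * si + (1 + a\<^sup>2) * S * C\<^sup>2 - 2 * a\<^sup>2 * S"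
    proof -
      have "W * ci\<^sup>2 * (W - a\<^sup>2 * S\<^sup>2) = W" using rel(3) sc(2) by algebra
      then have "si * (W * ci\<^sup>2 * (W - a\<^sup>2 * S\<^sup>2)) = si * W" by simp
      moreover have "si * (a\<^sup>2 * S\<^sup>2 * W * ci\<^sup>2) = a\<^sup>2 * S * W * ci\<^sup>2" using inv(2) by algebra
      ultimately have "W * W * ci\<^sup>2 * si - a\<^sup>2 * S * W * ci\<^sup>2 = W * si"
        by (simp add: algebra_simps power2_eq_square)
      moreover have "W * S - a\<^sup>2 * S = (1 + a\<^sup>2) * S * C\<^sup>2 - 2 * a\<^sup>2 * S" using rel by algebra
      ultimately show ?thesis by linarith
    qed
    moreover have "W * C\<^sup>2 * S * qi - W * W * S * qi\<^sup>2 + a\<^sup>2 * S * W * S\<^sup>2 * qi\<^sup>2 = 2 * W * S\<^sup>2 * C\<^sup>2 * qi\<^sup>2 * S"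
      using inv(3) rel by algebra
    ultimately show ?thesis unfolding AC D S2P by algebra
  qed
  show "g * (2 * C * R * P + S * P2) - 2 * f * (a * C * R) = A * (S * P) + B * (a * S)"
  proof -
    have "g * P2 = P * R * ((1 + a\<^sup>2) * S * C - 4 * S * C * qi * W - q * si * ci * W)"
      using second(2) efg(3) inv(4) by algebra
    moreover have "2 * C * W - q * ci * W = W * ci"
      using inv(1) rel(1,2) by algebra
    moreover have "a\<^sup>2 * S\<^sup>2 * C - a\<^sup>2 * S\<^sup>2 * S\<^sup>2 * ci = a\<^sup>2 * S\<^sup>2 * ci"
      using inv(1) rel(1) by algebra
    moreover have "A * (S * P) = P * R * (W * ci - 4 * S\<^sup>2 * C * W * qi + (1 + a\<^sup>2) * S\<^sup>2 * C - 2 * a\<^sup>2 * S\<^sup>2 * ci)"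
      using AB(1) inv(2) by algebra
    moreover have "S * (q * si * ci * W) = q * ci * W" using inv(2) by algebra
    moreover have "B * (a * S) = P * R * (- 2 * a\<^sup>2 * S\<^sup>2 * S\<^sup>2 * ci)"
      unfolding AB(2) efg(2) by algebra
    moreover have "g * (2 * C * R * P + S * P2) - 2 * f * (a * C * R) =
        P * R * (2 * C * W) + S * (g * P2) - P * R * (2 * a\<^sup>2 * S\<^sup>2 * C)"
      unfolding efg(2,3) by algebra
    ultimately show ?thesis by algebra
  qed
qed

lemma has_real_derivative_sqrt:
  assumes "(f has_real_derivative f') (at x)" "f x > 0"
  shows "((\<lambda>x. sqrt (f x)) has_real_derivative f' / (2 * sqrt (f x))) (at x)"
  using DERIV_chain2[OF DERIV_real_sqrt[OF assms(2)] assms(1)] by (simp add: field_simps)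

text \<open>
  In cylindrical coordinates \<open>(r, \<phi>, t)\<close> around a geodesic, the hyperbolic metric is
  \<open>dr\<^sup>2 + sinh\<^sup>2 r d\<phi>\<^sup>2 + cosh\<^sup>2 r dt\<^sup>2\<close>. Below, \<open>Q = cosh 2r\<close>, \<open>C = cosh r\<close>,
  \<open>S = sinh r\<close>, \<open>R = r'\<close>, \<open>P = \<psi>'\<close> along the generating curve, and \<open>W\<close> is the length of the
  Killing field \<open>\<partial>\<^sub>t + a \<partial>\<^sub>\<phi>\<close>. The invariant surface over a curve \<open>(r, \<psi>)\<close> is minimal when
  the curve is a geodesic of \<open>W\<^sup>2 dr\<^sup>2 + S\<^sup>2 C\<^sup>2 d\<psi>\<^sup>2\<close>; the formulas solve Clairaut's equation
  with constant \<open>c\<close>, in the parameter \<open>p\<close> given by \<open>S C = c cosh p\<close>.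
\<close>

locale screw_surface =
  fixes a c :: real
  assumes c_pos: "c > 0"
begin

definition Q :: "real \<Rightarrow> real" where "Q p = sqrt (1 + 4 * c\<^sup>2 * (cosh p)\<^sup>2)"
definition C :: "real \<Rightarrow> real" where "C p = sqrt ((Q p + 1) / 2)"
definition S :: "real \<Rightarrow> real" where "S p = sqrt ((Q p - 1) / 2)"
definition W :: "real \<Rightarrow> real" where "W p = sqrt ((C p)\<^sup>2 + a\<^sup>2 * (S p)\<^sup>2)"
definition R :: "real \<Rightarrow> real" where "R p = c * sinh p / Q p"
definition P :: "real \<Rightarrow> real" where "P p = W p / (Q p * cosh p)"
text \<open>The subtracted half angle makes the limits at the two ends opposite numbers. Integrating
  in the bounded variable gives these limits by continuity alone.\<close>

definition psi :: "real \<Rightarrow> real" where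
  "psi p = integral {- (pi/2)..arctan (sinh p)} (ang_vel a c) - total_angle a c / 2"

section \<open>Relations and derivatives along the generating curve\<close>

lemma Q_sq: "(Q p)\<^sup>2 = 1 + 4 * c\<^sup>2 * (cosh p)\<^sup>2"
  by (simp add: Q_def add_nonneg_nonneg)

lemma Q_gt_1: "Q p > 1"
  using c_pos by (simp add: Q_def)

lemma C_sq: "(C p)\<^sup>2 = (Q p + 1) / 2" and S_sq: "(S p)\<^sup>2 = (Q p - 1) / 2"
  and C_gt_1: "C p > 1" and S_pos: "S p > 0"
  using Q_gt_1[of p] by (simp_all add: C_def S_def)

lemma W_sq: "(W p)\<^sup>2 = (C p)\<^sup>2 + a\<^sup>2 * (S p)\<^sup>2" and W_pos: "W p > 0"
  using C_gt_1[of p] by (simp_all add: W_def add_pos_nonneg)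

lemma SC: "S p * C p = c * cosh p"
proof -
  have "(S p * C p)\<^sup>2 = ((Q p - 1) / 2) * ((Q p + 1) / 2)"
    unfolding power_mult_distrib C_sq S_sq ..
  also have "\<dots> = ((Q p)\<^sup>2 - 1) / 4"
    by (simp add: algebra_simps power2_eq_square)
  also have "\<dots> = (c * cosh p)\<^sup>2"
    unfolding Q_sq by (simp add: power_mult_distrib)
  finally have "(S p * C p)\<^sup>2 = (c * cosh p)\<^sup>2" .
  then show ?thesis
    by (rule power2_eq_imp_eq) (use S_pos[of p] C_gt_1[of p] c_pos in auto)
qed

lemma nonzero: "Q p \<noteq> 0" "C p \<noteq> 0" "S p \<noteq> 0" "W p \<noteq> 0"
  using Q_gt_1[of p] C_gt_1[of p] S_pos[of p] W_pos[of p] by auto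

text \<open>Derivatives are expressed through \<open>S\<close>, \<open>C\<close>, \<open>R\<close>,
  \<open>Q\<close> and \<open>W\<close> instead of \<open>cosh p\<close> and \<open>sinh p\<close>,
  so that differentiation never leaves one small family of functions.\<close>

lemma Q_deriv: "(Q has_real_derivative 4 * S p * C p * R p) (at p)"
proof -
  have "((\<lambda>p. 1 + 4 * c\<^sup>2 * (cosh p)\<^sup>2) has_real_derivative 8 * c\<^sup>2 * cosh p * sinh p) (at p)"
    by (auto intro!: derivative_eq_intros)
  then have "(Q has_real_derivative 8 * c\<^sup>2 * cosh p * sinh p / (2 * Q p)) (at p)"
    unfolding Q_def[abs_def] by (rule has_real_derivative_sqrt) (simp add: add_pos_nonneg)
  also have "8 * c\<^sup>2 * cosh p * sinh p / (2 * Q p) = 4 * (S p * C p) * R p"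
    unfolding SC by (simp add: R_def power2_eq_square)
  finally show ?thesis by (simp add: mult.assoc)
qed

lemma C_deriv: "(C has_real_derivative S p * R p) (at p)"
proof -
  have "((\<lambda>p. (Q p + 1) / 2) has_real_derivative 2 * S p * C p * R p) (at p)"
    by (auto intro!: derivative_eq_intros Q_deriv)
  then have "(C has_real_derivative 2 * S p * C p * R p / (2 * C p)) (at p)"
    unfolding C_def[of p] C_def[abs_def] using Q_gt_1[of p]
    by (intro has_real_derivative_sqrt) auto
  then show ?thesis using nonzero(2)[of p] by simp
qed

lemma S_deriv: "(S has_real_derivative C p * R p) (at p)"
proof -
  have "((\<lambda>p. (Q p - 1) / 2) has_real_derivative 2 * S p * C p * R p) (at p)"
    by (auto intro!: derivative_eq_intros Q_deriv)
  then have "(S has_real_derivative 2 * S p * C p * R p / (2 * S p)) (at p)"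
    unfolding S_def[of p] S_def[abs_def] using Q_gt_1[of p]
    by (intro has_real_derivative_sqrt) auto
  then show ?thesis using nonzero(3)[of p] by simp
qed

lemma R_deriv: "(R has_real_derivative S p * C p * (1 - 4 * (R p)\<^sup>2) * (1 / Q p)) (at p)"
proof -
  have "(R has_real_derivative (c * cosh p * Q p - c * sinh p * (4 * S p * C p * R p)) / (Q p)\<^sup>2) (at p)"
    unfolding R_def[abs_def] using nonzero(1)[of p]
    by (auto intro!: derivative_eq_intros Q_deriv) (simp add: R_def field_simps power2_eq_square)
  moreover have "c * sinh p = R p * Q p" using nonzero(1)[of p] by (simp add: R_def)
  then have "(c * cosh p * Q p - c * sinh p * (4 * S p * C p * R p)) / (Q p)\<^sup>2 =
      S p * C p * (1 - 4 * (R p)\<^sup>2) * (1 / Q p)"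
    using nonzero(1)[of p] by (simp add: SC[symmetric]) (simp add: field_simps power2_eq_square)
  ultimately show ?thesis by simp
qed

lemma W_deriv: "(W has_real_derivative (1 + a\<^sup>2) * S p * C p * R p / W p) (at p)"
proof -
  have "((\<lambda>p. (C p)\<^sup>2 + a\<^sup>2 * (S p)\<^sup>2) has_real_derivative 2 * ((1 + a\<^sup>2) * S p * C p * R p)) (at p)"
    by (auto intro!: derivative_eq_intros C_deriv S_deriv simp: algebra_simps)
  moreover have "(C p)\<^sup>2 + a\<^sup>2 * (S p)\<^sup>2 > 0"
    using C_gt_1[of p] by (simp add: add_pos_nonneg)
  ultimately have "(W has_real_derivative 2 * ((1 + a\<^sup>2) * S p * C p * R p) / (2 * W p)) (at p)"
    unfolding W_def[of p] W_def[abs_def] by (rule has_real_derivative_sqrt)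
  then show ?thesis by simp
qed

text \<open>\<open>P\<close> times the logarithmic derivative of \<open>W / (Q cosh)\<close>, where
  \<open>tanh p\<close> is written as \<open>R Q / (S C)\<close>.\<close>

definition P' :: "real \<Rightarrow> real" where
  "P' p = P p * R p * ((1 + a\<^sup>2) * S p * C p * (1 / (W p)\<^sup>2) - 4 * S p * C p * (1 / Q p) - Q p * (1 / S p) * (1 / C p))"

lemma P_deriv: "(P has_real_derivative P' p) (at p)"
proof -
  have ch: "cosh p > 0" by (rule cosh_real_pos)
  have sinh: "sinh p = R p * Q p / c" using nonzero(1)[of p] c_pos by (simp add: R_def)
  have cosh: "cosh p = S p * C p / c" using c_pos SC[of p] by simp
  have "(P has_real_derivative ((1 + a\<^sup>2) * S p * C p * R p / W p * (Q p * cosh p)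
      - W p * (4 * S p * C p * R p * cosh p + Q p * sinh p)) / (Q p * cosh p)\<^sup>2) (at p)"
    unfolding P_def[abs_def] using nonzero[of p] ch
    by (auto intro!: derivative_eq_intros Q_deriv W_deriv simp: power2_eq_square)
  also have "((1 + a\<^sup>2) * S p * C p * R p / W p * (Q p * cosh p)
      - W p * (4 * S p * C p * R p * cosh p + Q p * sinh p)) / (Q p * cosh p)\<^sup>2 = P' p"
    unfolding P'_def P_def sinh using nonzero[of p] c_pos ch
    by (simp add: field_simps power2_eq_square SC) (simp add: cosh field_simps)
  finally show ?thesis .
qed

text \<open>Clairaut's relation in the parameter \<open>p\<close>: after multiplication by
  \<open>(S p * C p)\<^sup>2\<close> it says that the curve has speed \<open>S C W / Q\<close> in
  the metric on the orbit space. It rests on \<open>cosh\<^sup>2 - sinh\<^sup>2 = 1\<close>.\<close>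

lemma P_sq: "(P p)\<^sup>2 = (W p)\<^sup>2 * ((1 / Q p)\<^sup>2 - (R p)\<^sup>2 * (1 / C p)\<^sup>2 * (1 / S p)\<^sup>2)"
proof -
  have ch: "cosh p > 0" by (rule cosh_real_pos)
  have "(1 / C p)\<^sup>2 * (1 / S p)\<^sup>2 = 1 / (c * cosh p)\<^sup>2"
    by (simp add: SC[symmetric] power_mult_distrib power_divide)
  then have "(R p)\<^sup>2 * (1 / C p)\<^sup>2 * (1 / S p)\<^sup>2 = (sinh p)\<^sup>2 / ((Q p)\<^sup>2 * (cosh p)\<^sup>2)"
    using c_pos ch nonzero(1)[of p] by (simp add: R_def power_mult_distrib power_divide mult.assoc) 
  moreover have "(1 / Q p)\<^sup>2 = (cosh p)\<^sup>2 / ((Q p)\<^sup>2 * (cosh p)\<^sup>2)"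
    using ch by (simp add: power_divide)
  ultimately have "(1 / Q p)\<^sup>2 - (R p)\<^sup>2 * (1 / C p)\<^sup>2 * (1 / S p)\<^sup>2 =
      ((cosh p)\<^sup>2 - (sinh p)\<^sup>2) / ((Q p)\<^sup>2 * (cosh p)\<^sup>2)"
    by (simp only: diff_divide_distrib)
  then show ?thesis
    by (simp only: hyperbolic_pythagoras) (simp add: P_def power_divide power_mult_distrib)
qed

text \<open>For \<open>\<theta> = arctan (sinh p)\<close> both \<open>cos \<theta>\<close> and the
  derivative of \<open>\<theta>\<close> in \<open>p\<close> equal \<open>1 / cosh p\<close>. The
  variable \<open>y\<close> of \<open>ang_vel\<close> becomes \<open>1 / Q p\<close> and
  \<open>ang_vel\<close> becomes \<open>W p / Q p\<close>.\<close>

lemma ang_vel_arctan_sinh: "ang_vel a c (arctan (sinh p)) * (1 / cosh p) = P p"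
proof -
  have ch: "cosh p > 0" by (rule cosh_real_pos)
  have cos: "cos (arctan (sinh p)) = 1 / cosh p"
    using ch by (simp add: cos_arctan cosh_square_eq[symmetric] add.commute[of 1])
  have "(cos (arctan (sinh p)))\<^sup>2 + 4 * c\<^sup>2 = (Q p / cosh p)\<^sup>2"
    using ch by (simp add: cos Q_sq power_divide field_simps)
  then have "sqrt ((cos (arctan (sinh p)))\<^sup>2 + 4 * c\<^sup>2) = Q p / cosh p"
    using ch Q_gt_1[of p] by simp
  then have y: "cos (arctan (sinh p)) / sqrt ((cos (arctan (sinh p)))\<^sup>2 + 4 * c\<^sup>2) = 1 / Q p"
    using ch by (simp add: cos)
  have "((1 + a\<^sup>2) * (1 / Q p) + (1 - a\<^sup>2) * (1 / Q p)\<^sup>2) / 2 = (W p / Q p)\<^sup>2"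
    using nonzero(1)[of p] by (simp add: power_divide W_sq C_sq S_sq) (simp add: field_simps power2_eq_square)
  then have "ang_vel a c (arctan (sinh p)) = W p / Q p"
    unfolding ang_vel_def y Let_def using Q_gt_1[of p] W_pos[of p] by simp
  then show ?thesis by (simp add: P_def)
qed

lemma psi_deriv: "(psi has_real_derivative P p) (at p)"
proof -
  let ?I = "\<lambda>x. integral {- (pi/2)..x} (ang_vel a c)"
  have ch: "cosh p > 0" by (rule cosh_real_pos)
  have "arctan (sinh p) \<in> {- (pi/2)<..<pi/2}"
    using arctan_bounded[of "sinh p"] by auto
  then have "(?I has_real_derivative ang_vel a c (arctan (sinh p))) (at (arctan (sinh p)))"
    using integral_has_real_derivative[OF continuous_on_ang_vel'[OF c_pos], of "arctan (sinh p)" "- (pi/2)" "pi/2" a]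
    by (simp add: at_within_Icc_at)
  moreover have "((\<lambda>p. arctan (sinh p)) has_real_derivative 1 / cosh p) (at p)"
  proof -
    have "1 + (sinh p)\<^sup>2 = (cosh p)\<^sup>2" by (simp add: cosh_square_eq)
    then have "inverse (1 + (sinh p)\<^sup>2) * cosh p = 1 / cosh p"
      using ch by (simp only:) (simp add: power2_eq_square field_simps)
    then show ?thesis
      using DERIV_chain2[OF DERIV_arctan has_field_derivative_sinh[OF DERIV_ident], of p] by simp
  qed
  ultimately have "((\<lambda>p. ?I (arctan (sinh p))) has_real_derivative P p) (at p)"
    unfolding ang_vel_arctan_sinh[symmetric] by (rule DERIV_chain2)
  then show ?thesis
    unfolding psi_def[abs_def] by (auto intro!: derivative_eq_intros)
qed

section \<open>The surface in the hyperboloid and its mean curvature\<close>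

definition phi :: "real^2 \<Rightarrow> real" where "phi u = psi (u $ 1) + a * u $ 2"

text \<open>One more than the time coordinate of the hyperboloid point
  \<open>(C cosh t, C sinh t, S cos phi, S sin phi)\<close>; the three space coordinates form
  \<open>Y\<close>. The summand 1 belongs to the stereographic projection.\<close>

definition h :: "real^2 \<Rightarrow> real" where "h u = 1 + C (u $ 1) * cosh (u $ 2)"

definition Y :: "real^2 \<Rightarrow> real^3" where
  "Y u = vector [C (u $ 1) * sinh (u $ 2), S (u $ 1) * cos (phi u), S (u $ 1) * sin (phi u)]"

definition F :: "real^2 \<Rightarrow> real^3" where "F u = (1 / h u) *\<^sub>R Y u"

definition h1 where "h1 u = S (u $ 1) * R (u $ 1) * cosh (u $ 2)"
definition h2 where "h2 u = C (u $ 1) * sinh (u $ 2)"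
definition Y1 :: "real^2 \<Rightarrow> real^3" where
  "Y1 u = vector [S (u $ 1) * R (u $ 1) * sinh (u $ 2),
     C (u $ 1) * R (u $ 1) * cos (phi u) - S (u $ 1) * P (u $ 1) * sin (phi u),
     C (u $ 1) * R (u $ 1) * sin (phi u) + S (u $ 1) * P (u $ 1) * cos (phi u)]"
definition Y2 :: "real^2 \<Rightarrow> real^3" where
  "Y2 u = vector [C (u $ 1) * cosh (u $ 2), - (a * S (u $ 1) * sin (phi u)), a * S (u $ 1) * cos (phi u)]"

definition R' where "R' p = S p * C p * (1 - 4 * (R p)\<^sup>2) * (1 / Q p)"
definition C'' where "C'' p = C p * (R p)\<^sup>2 + S p * R' p"
definition S'' where "S'' p = S p * (R p)\<^sup>2 + C p * R' p"

lemmas partials_C = has_partials_fst[OF C_deriv]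
lemmas partials_S = has_partials_fst[OF S_deriv]
lemmas partials_R = has_partials_fst[OF R_deriv, folded R'_def]
lemmas partials_P = has_partials_fst[OF P_deriv]

lemma partials_cosh: "has_partials (\<lambda>u. cosh (u $ 2)) (\<lambda>u. 0) (\<lambda>u. sinh (u $ 2))"
  by (rule has_partials_snd) (auto intro!: derivative_eq_intros)

lemma partials_sinh: "has_partials (\<lambda>u. sinh (u $ 2)) (\<lambda>u. 0) (\<lambda>u. cosh (u $ 2))"
  by (rule has_partials_snd) (auto intro!: derivative_eq_intros)

lemma partials_phi: "has_partials phi (\<lambda>u. P (u $ 1)) (\<lambda>u. a)"
  unfolding phi_def[abs_def]
  by (rule has_partials_cong[OF has_partials_add[OF has_partials_fst[OF psi_deriv]
        has_partials_mult[OF has_partials_const has_partials_nth(2)]]]) simp_all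

lemma partials_cos_phi: "has_partials (\<lambda>u. cos (phi u)) (\<lambda>u. - sin (phi u) * P (u $ 1)) (\<lambda>u. - sin (phi u) * a)"
  by (rule has_partials_chain[OF partials_phi]) (auto intro!: derivative_eq_intros)

lemma partials_sin_phi: "has_partials (\<lambda>u. sin (phi u)) (\<lambda>u. cos (phi u) * P (u $ 1)) (\<lambda>u. cos (phi u) * a)"
  by (rule has_partials_chain[OF partials_phi]) (auto intro!: derivative_eq_intros)

lemma partials_S_R: "has_partials (\<lambda>u. S (u $ 1) * R (u $ 1)) (\<lambda>u. C'' (u $ 1)) (\<lambda>u. 0)"
  by (rule has_partials_cong[OF has_partials_mult[OF partials_S partials_R]]) (simp_all add: C''_def power2_eq_square)

lemma partials_C_R: "has_partials (\<lambda>u. C (u $ 1) * R (u $ 1)) (\<lambda>u. S'' (u $ 1)) (\<lambda>u. 0)"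
  by (rule has_partials_cong[OF has_partials_mult[OF partials_C partials_R]]) (simp_all add: S''_def power2_eq_square)

lemma partials_S_P: "has_partials (\<lambda>u. S (u $ 1) * P (u $ 1))
    (\<lambda>u. C (u $ 1) * R (u $ 1) * P (u $ 1) + S (u $ 1) * P' (u $ 1)) (\<lambda>u. 0)"
  by (rule has_partials_cong[OF has_partials_mult[OF partials_S partials_P]]) simp_all

lemma partials_h: "has_partials h h1 h2"
  unfolding h_def[abs_def]
  by (rule has_partials_cong[OF has_partials_add[OF has_partials_const has_partials_mult[OF partials_C partials_cosh]]])
    (simp_all add: h1_def h2_def)

lemma partials_h1: "has_partials h1 (\<lambda>u. C'' (u $ 1) * cosh (u $ 2)) (\<lambda>u. S (u $ 1) * R (u $ 1) * sinh (u $ 2))"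
  unfolding h1_def[abs_def]
  by (rule has_partials_cong[OF has_partials_mult[OF partials_S_R partials_cosh]]) simp_all

lemma partials_h2: "has_partials h2 (\<lambda>u. S (u $ 1) * R (u $ 1) * sinh (u $ 2)) (\<lambda>u. C (u $ 1) * cosh (u $ 2))"
  unfolding h2_def[abs_def]
  by (rule has_partials_cong[OF has_partials_mult[OF partials_C partials_sinh]]) simp_all

lemma partials_Y: "has_partials Y Y1 Y2"
  unfolding Y_def[abs_def]
  by (rule has_partials_cong[OF has_partials_vector3[OF has_partials_mult[OF partials_C partials_sinh]
        has_partials_mult[OF partials_S partials_cos_phi] has_partials_mult[OF partials_S partials_sin_phi]]])
    (simp_all add: Y1_def Y2_def vec_eq_iff forall_3 mult_ac)

definition Y11 :: "real^2 \<Rightarrow> real^3" where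
  "Y11 u = (let p = u $ 1; s = S'' p - S p * (P p)\<^sup>2; d = 2 * C p * R p * P p + S p * P' p in
     vector [C'' p * sinh (u $ 2), s * cos (phi u) - d * sin (phi u), s * sin (phi u) + d * cos (phi u)])"

definition Y21 :: "real^2 \<Rightarrow> real^3" where
  "Y21 u = (let p = u $ 1 in vector [S p * R p * cosh (u $ 2),
     - (a * C p * R p * sin (phi u) + a * S p * P p * cos (phi u)),
     a * C p * R p * cos (phi u) - a * S p * P p * sin (phi u)])"

definition Y22 :: "real^2 \<Rightarrow> real^3" where
  "Y22 u = (let p = u $ 1 in vector [C p * sinh (u $ 2),
     - (a\<^sup>2 * S p * cos (phi u)), - (a\<^sup>2 * S p * sin (phi u))])"

lemma partials_Y1: "has_partials Y1 Y11 Y21"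
  unfolding Y1_def[abs_def]
  by (rule has_partials_cong[OF has_partials_vector3[OF has_partials_mult[OF partials_S_R partials_sinh]
        has_partials_diff[OF has_partials_mult[OF partials_C_R partials_cos_phi] has_partials_mult[OF partials_S_P partials_sin_phi]]
        has_partials_add[OF has_partials_mult[OF partials_C_R partials_sin_phi] has_partials_mult[OF partials_S_P partials_cos_phi]]]])
    (simp_all add: Y11_def Y21_def Let_def vec_eq_iff forall_3 algebra_simps power2_eq_square)

lemma partials_Y2: "has_partials Y2 Y21 Y22"
proof -
  note paS = has_partials_mult[OF has_partials_const[of a] partials_S]
  note p = has_partials_vector3[OF has_partials_mult[OF partials_C partials_cosh]
        has_partials_diff[OF has_partials_const[of 0] has_partials_mult[OF paS partials_sin_phi]] has_partials_mult[OF paS partials_cos_phi]]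
  have "(\<lambda>u. vector [C (u $ 1) * cosh (u $ 2), 0 - a * S (u $ 1) * sin (phi u), a * S (u $ 1) * cos (phi u)]) = Y2"
    by (simp add: fun_eq_iff Y2_def)
  then show ?thesis
    using has_partials_cong[OF p, of Y21 Y22]
    by (simp add: Y21_def Y22_def Let_def vec_eq_iff forall_3 algebra_simps power2_eq_square)
qed

lemma h_gt_1: "h u > 1"
  using C_gt_1[of "u $ 1"] by (simp add: h_def cosh_real_pos)

lemma C_S: "(C p)\<^sup>2 = (S p)\<^sup>2 + 1" and Q_eq: "Q p = (C p)\<^sup>2 + (S p)\<^sup>2"
  by (simp_all add: C_sq S_sq field_simps)

lemma hyperboloid: "(h u - 1)\<^sup>2 = 1 + Y u \<bullet> Y u"
proof -
  have "(cosh (u $ 2))\<^sup>2 = (sinh (u $ 2))\<^sup>2 + 1" "(sin (phi u))\<^sup>2 + (cos (phi u))\<^sup>2 = 1"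
    by (simp_all add: cosh_square_eq)
  with C_S[of "u $ 1"] show ?thesis
    unfolding h_def Y_def inner_vector3 by algebra
qed

lemma tangent:
  "(h u - 1) * h1 u = Y u \<bullet> Y1 u" "(h u - 1) * h2 u = Y u \<bullet> Y2 u"
proof -
  have "(cosh (u $ 2))\<^sup>2 = (sinh (u $ 2))\<^sup>2 + 1" "(sin (phi u))\<^sup>2 + (cos (phi u))\<^sup>2 = 1"
    by (simp_all add: cosh_square_eq)
  then show "(h u - 1) * h1 u = Y u \<bullet> Y1 u" "(h u - 1) * h2 u = Y u \<bullet> Y2 u"
    unfolding h_def Y_def h1_def Y1_def h2_def Y2_def inner_vector3 using C_S[of "u $ 1"] by (algebra, simp add: algebra_simps)
qed

lemma first_form_eqs:
  "Y1 u \<bullet> Y1 u - h1 u * h1 u = (R (u $ 1))\<^sup>2 + (S (u $ 1))\<^sup>2 * (P (u $ 1))\<^sup>2" (is ?e)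
  "Y1 u \<bullet> Y2 u - h1 u * h2 u = a * (S (u $ 1))\<^sup>2 * P (u $ 1)" (is ?f)
  "Y2 u \<bullet> Y2 u - h2 u * h2 u = (W (u $ 1))\<^sup>2" (is ?g)
proof -
  have "(cosh (u $ 2))\<^sup>2 = (sinh (u $ 2))\<^sup>2 + 1" "(sin (phi u))\<^sup>2 + (cos (phi u))\<^sup>2 = 1"
    by (simp_all add: cosh_square_eq)
  with C_S[of "u $ 1"] W_sq[of "u $ 1"] show ?e ?f ?g
    unfolding h1_def Y1_def h2_def Y2_def inner_vector3 by algebra+
qed

lemma mean_curvature_F: "mean_curvature F u = 0"
proof -
  define p where "p = u $ 1"
  define e f g where "e = (R p)\<^sup>2 + (S p)\<^sup>2 * (P p)\<^sup>2" and "f = a * (S p)\<^sup>2 * P p" and "g = (W p)\<^sup>2"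
  define A where "A = R p * ((W p)\<^sup>2 * (1 / S p) * (1 / C p) - 4 * S p * C p * (W p)\<^sup>2 * (1 / Q p)
    + (1 + a\<^sup>2) * S p * C p - 2 * a\<^sup>2 * S p * (1 / C p))"
  define B where "B = - 2 * f * S p * R p * (1 / C p)"
  note identities = screw_minimality_identities[where C = "C p" and S = "S p" and q = "Q p" and R = "R p"
      and P = "P p" and W = "(W p)\<^sup>2" and ci = "1 / C p" and si = "1 / S p" and qi = "1 / Q p" and Wi = "1 / (W p)\<^sup>2"
      and a = a and ?R2.0 = "R' p" and ?P2.0 = "P' p",
      OF _ _ _ _ C_S Q_eq W_sq P_sq R'_def P'_def e_def f_def g_def A_def B_def]
  have id: "g * C'' p + e * C p = A * (S p * R p) + 2 * (e * g - f\<^sup>2) * C p"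
    "- 2 * f * (S p * R p) = B * C p"
    "g * (S'' p - S p * (P p)\<^sup>2) + 2 * f * (a * S p * P p) - e * (a\<^sup>2 * S p) =
       A * (C p * R p) + 2 * (e * g - f\<^sup>2) * S p"
    "g * (2 * C p * R p * P p + S p * P' p) - 2 * f * (a * C p * R p) = A * (S p * P p) + B * (a * S p)"
    unfolding C''_def S''_def using identities nonzero[of p] by simp_all
  have linY: "g *\<^sub>R Y11 u - (2 * f) *\<^sub>R Y21 u + e *\<^sub>R Y22 u =
      A *\<^sub>R Y1 u + B *\<^sub>R Y2 u + (2 * (e * g - f\<^sup>2)) *\<^sub>R Y u"
  proof -
    have "g * (C'' p * sinh (u $ 2)) - 2 * f * (S p * R p * cosh (u $ 2)) + e * (C p * sinh (u $ 2)) =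
        A * (S p * R p * sinh (u $ 2)) + B * (C p * cosh (u $ 2)) + 2 * (e * g - f\<^sup>2) * (C p * sinh (u $ 2))"
      using id(1,2) by algebra
    \<comment> \<open>\<open>x\<close> and \<open>y\<close> stand for the cosine and sine of
      \<open>phi u\<close>. The claim is linear in them, so it follows from the radial and angular
      identities without trigonometry.\<close>
    moreover have "g * ((S'' p - S p * (P p)\<^sup>2) * x - (2 * C p * R p * P p + S p * P' p) * y)
        - 2 * f * (- (a * C p * R p * y + a * S p * P p * x)) + e * (- (a\<^sup>2 * S p * x)) =
        A * (C p * R p * x - S p * P p * y) + B * (- (a * S p * y)) + 2 * (e * g - f\<^sup>2) * (S p * x)" for x y
      using id(3,4) by algebra
    moreover have "g * ((S'' p - S p * (P p)\<^sup>2) * y + (2 * C p * R p * P p + S p * P' p) * x)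
        - 2 * f * (a * C p * R p * x - a * S p * P p * y) + e * (- (a\<^sup>2 * S p * y)) =
        A * (C p * R p * y + S p * P p * x) + B * (a * S p * x) + 2 * (e * g - f\<^sup>2) * (S p * y)" for x y
      using id(3,4) by algebra
    ultimately show ?thesis
      unfolding Y11_def Y21_def Y22_def Y1_def Y2_def Y_def Let_def p_def[symmetric]
      by (simp only: vec_eq_iff forall_3 vector_add_component vector_minus_component
          vector_scaleR_component vector_3 real_scaleR_def simp_thms)
  qed
  have linh: "g * (C'' (u $ 1) * cosh (u $ 2)) - 2 * f * (S (u $ 1) * R (u $ 1) * sinh (u $ 2)) +
        e * (C (u $ 1) * cosh (u $ 2)) =
      A * h1 u + B * h2 u + 2 * (e * g - f\<^sup>2) * (h u - 1)"
    unfolding h1_def h2_def h_def p_def[symmetric] using id(1,2) by algebra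
  have efg: "e = Y1 u \<bullet> Y1 u - h1 u * h1 u" "f = Y1 u \<bullet> Y2 u - h1 u * h2 u" "g = Y2 u \<bullet> Y2 u - h2 u * h2 u"
    by (simp_all only: first_form_eqs e_def f_def g_def p_def)
  show ?thesis
    unfolding F_def[abs_def]
    by (rule mean_curvature_stereographic_eq_0[OF partials_h partials_h1 partials_h2 partials_Y partials_Y1 partials_Y2 h_gt_1 hyperboloid tangent efg linY linh])
qed

section \<open>Induced metric and immersion\<close>

definition F1 where "F1 u = (1 / h u) *\<^sub>R (Y1 u - h1 u *\<^sub>R F u)"
definition F2 where "F2 u = (1 / h u) *\<^sub>R (Y2 u - h2 u *\<^sub>R F u)"

lemma partials_F: "has_partials F F1 F2"
proof -
  have "h u \<noteq> 0" for u using h_gt_1[of u] by simp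
  from has_partials_stereographic[OF partials_h partials_Y this] show ?thesis
    unfolding F_def[abs_def] F1_def[abs_def] F2_def[abs_def] .
qed

lemma norm_F: "norm (F u) < 1" and conformal_factor: "2 / (1 - (norm (F u))\<^sup>2) = h u"
  using hyp_metric_stereographic(1,2)[OF h_gt_1 hyperboloid tangent(1) tangent(1)]
  unfolding F_def by auto

text \<open>The cylindrical metric evaluated on \<open>dr = R x\<close>,
  \<open>d phi = P x + a y\<close>, \<open>dt = y\<close>.\<close>

lemma metric_F:
  "hyp_metric (F u) (x *\<^sub>R F1 u + y *\<^sub>R F2 u) (x *\<^sub>R F1 u + y *\<^sub>R F2 u) =
     (R (u $ 1) * x)\<^sup>2 + (S (u $ 1) * (P (u $ 1) * x + a * y))\<^sup>2 + (C (u $ 1) * y)\<^sup>2"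
proof -
  define V where "V = x *\<^sub>R Y1 u + y *\<^sub>R Y2 u"
  define b where "b = x * h1 u + y * h2 u"
  have t: "(h u - 1) * b = Y u \<bullet> V"
    using tangent[of u] by (simp add: V_def b_def inner_add_right algebra_simps)
  have "x *\<^sub>R F1 u + y *\<^sub>R F2 u = (1 / h u) *\<^sub>R (V - b *\<^sub>R F u)"
    unfolding F1_def F2_def V_def b_def by (simp add: algebra_simps)
  then have "hyp_metric (F u) (x *\<^sub>R F1 u + y *\<^sub>R F2 u) (x *\<^sub>R F1 u + y *\<^sub>R F2 u) = V \<bullet> V - b * b"
    using hyp_metric_stereographic(3)[OF h_gt_1 hyperboloid t t] by (simp add: F_def)
  also have "V \<bullet> V - b * b = x\<^sup>2 * (Y1 u \<bullet> Y1 u - h1 u * h1 u) + 2 * x * y * (Y1 u \<bullet> Y2 u - h1 u * h2 u)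
      + y\<^sup>2 * (Y2 u \<bullet> Y2 u - h2 u * h2 u)"
    by (simp add: V_def b_def inner_add_left inner_add_right inner_commute[of "Y2 u" "Y1 u"]
        algebra_simps power2_eq_square)
  also have "\<dots> = (R (u $ 1) * x)\<^sup>2 + (S (u $ 1) * (P (u $ 1) * x + a * y))\<^sup>2 + (C (u $ 1) * y)\<^sup>2"
    unfolding first_form_eqs W_sq by algebra
  finally show ?thesis .
qed

text \<open>The constant \<open>c\<^sup>2 / (1 + 4 * c\<^sup>2)\<close> is the value of
  \<open>(S C / Q)\<^sup>2\<close> at \<open>p = 0\<close>, its minimum. The extra factor 1/2 pays
  for adding the separate bounds for the two components of the vector.\<close>

definition expansion :: real where "expansion = sqrt (c\<^sup>2 / (1 + 4 * c\<^sup>2) / 2)"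

lemma expansion_pos: "expansion > 0"
  using c_pos by (simp add: expansion_def add_pos_nonneg)

text \<open>
  The part of the metric orthogonal to the orbits is \<open>(S C / Q)\<^sup>2 dp\<^sup>2\<close>, which is bounded below by
  a multiple of \<open>dp\<^sup>2\<close>, and \<open>t\<close> is a 1-Lipschitz function.
\<close>

lemma hyp_norm_F_ge:
  fixes v :: "real^2"
  shows "expansion * norm v \<le> hyp_norm (F u) (v $ 1 *\<^sub>R F1 u + v $ 2 *\<^sub>R F2 u)"
proof -
  define p x y where "p = u $ 1" and "x = v $ 1" and "y = v $ 2"
  define E where "E = (R p * x)\<^sup>2 + (S p * (P p * x + a * y))\<^sup>2 + (C p * y)\<^sup>2"
  define k where "k = c\<^sup>2 / (1 + 4 * c\<^sup>2)"
  have k: "k \<ge> 0" "k \<le> 1"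
    by (simp_all add: k_def divide_le_eq_1 add_pos_nonneg)
  have Ey: "y\<^sup>2 \<le> E"
  proof -
    have "1 * y\<^sup>2 \<le> (C p)\<^sup>2 * y\<^sup>2"
      using C_gt_1[of p] by (intro mult_right_mono one_le_power) auto
    moreover have "0 \<le> (R p * x)\<^sup>2" "0 \<le> (S p * (P p * x + a * y))\<^sup>2" by simp_all
    ultimately show ?thesis unfolding E_def power_mult_distrib[of "C p"] by linarith
  qed
  have Ex: "k * x\<^sup>2 \<le> E"
  proof -
    have Ck: "k * (Q p)\<^sup>2 \<le> (S p * C p)\<^sup>2"
    proof -
      have "1 \<le> (cosh p)\<^sup>2" using cosh_real_ge_1[of p] by (simp add: one_le_power)
      then have "c\<^sup>2 * (1 + 4 * c\<^sup>2 * (cosh p)\<^sup>2) \<le> (c\<^sup>2 * (cosh p)\<^sup>2) * (1 + 4 * c\<^sup>2)"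
        using mult_left_mono[of 1 "(cosh p)\<^sup>2" "c\<^sup>2"] by (simp add: algebra_simps)
      then show ?thesis
        unfolding SC Q_sq k_def by (simp add: power_mult_distrib divide_le_eq add_pos_nonneg)
    qed
    have W2: "(W p)\<^sup>2 > 0" using W_pos[of p] by simp
    have S2P: "(S p)\<^sup>2 * (P p)\<^sup>2 = (W p)\<^sup>2 * ((S p)\<^sup>2 * (1 / Q p)\<^sup>2 - (R p)\<^sup>2 * (1 / C p)\<^sup>2)"
      unfolding P_sq using nonzero[of p] by (simp add: algebra_simps power_divide)
    \<comment> \<open>Completing the square in \<open>y\<close> splits off the component along the
      Killing orbit; what remains is the part orthogonal to the orbits.\<close>
    have "(W p)\<^sup>2 * E = ((W p)\<^sup>2 * ((R p)\<^sup>2 + (S p)\<^sup>2 * (P p)\<^sup>2) - a\<^sup>2 * (S p)\<^sup>2 * ((S p)\<^sup>2 * (P p)\<^sup>2)) * x\<^sup>2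
        + (a * (S p)\<^sup>2 * P p * x + (W p)\<^sup>2 * y)\<^sup>2"
      unfolding E_def W_sq by algebra
    also have "(W p)\<^sup>2 * ((R p)\<^sup>2 + (S p)\<^sup>2 * (P p)\<^sup>2) - a\<^sup>2 * (S p)\<^sup>2 * ((S p)\<^sup>2 * (P p)\<^sup>2) =
        (W p)\<^sup>2 * (R p)\<^sup>2 + (C p)\<^sup>2 * ((S p)\<^sup>2 * (P p)\<^sup>2)"
      unfolding W_sq by algebra
    also have "\<dots> = (W p)\<^sup>2 * ((S p * C p)\<^sup>2 * (1 / Q p)\<^sup>2)"
      unfolding S2P using nonzero(2)[of p] by (simp add: algebra_simps power_divide power_mult_distrib)
    finally have "(W p)\<^sup>2 * ((S p * C p)\<^sup>2 * (1 / Q p)\<^sup>2 * x\<^sup>2) \<le> (W p)\<^sup>2 * E" by simp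
    then have "(S p * C p)\<^sup>2 * (1 / Q p)\<^sup>2 * x\<^sup>2 \<le> E" using W2 by simp
    moreover have "k * x\<^sup>2 \<le> (S p * C p)\<^sup>2 * (1 / Q p)\<^sup>2 * x\<^sup>2"
    proof (rule mult_right_mono)
      have "k * (Q p)\<^sup>2 * (1 / Q p)\<^sup>2 \<le> (S p * C p)\<^sup>2 * (1 / Q p)\<^sup>2"
        using Ck by (rule mult_right_mono) simp
      then show "k \<le> (S p * C p)\<^sup>2 * (1 / Q p)\<^sup>2" using nonzero(1)[of p] by (simp add: power_divide)
    qed simp
    ultimately show ?thesis by simp
  qed
  have nv: "(norm v)\<^sup>2 = x\<^sup>2 + y\<^sup>2"
    unfolding power2_norm_eq_inner by (simp add: inner_vec_def sum_2 x_def y_def power2_eq_square)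
  have "k * y\<^sup>2 \<le> y\<^sup>2" using k by (simp add: mult_left_le_one_le)
  then have "k * (norm v)\<^sup>2 \<le> 2 * E" using Ex Ey by (simp add: nv algebra_simps)
  moreover have "(expansion * norm v)\<^sup>2 = k * (norm v)\<^sup>2 / 2"
    using k(1) by (simp add: expansion_def k_def power_mult_distrib)
  ultimately have "(expansion * norm v)\<^sup>2 \<le> E" by simp
  then show ?thesis
    unfolding hyp_norm_def metric_F E_def p_def x_def y_def by (rule real_le_rsqrt)
qed

text \<open>The estimate behind completeness already forbids a kernel: a vector with zero image has
  hyperbolic length 0.\<close>

lemma immersion_F: "inj (frechet_derivative F (at u))"
proof (rule injI)
  fix v w assume "frechet_derivative F (at u) v = frechet_derivative F (at u) w"
  then have "(v - w) $ 1 *\<^sub>R F1 u + (v - w) $ 2 *\<^sub>R F2 u = 0"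
    by (simp add: has_partials_frechet[OF partials_F] scaleR_diff_left algebra_simps)
  then have "expansion * norm (v - w) \<le> 0"
    using hyp_norm_F_ge[of "v - w" u] by (simp add: hyp_norm_def hyp_metric_def)
  then show "v = w" using expansion_pos by (simp add: mult_le_0_iff)
qed

lemma continuous_F1: "continuous_on UNIV F1" and continuous_F2: "continuous_on UNIV F2"
proof -
  have cont: "continuous_on UNIV f" if "has_partials f f1 f2" for f :: "real^2 \<Rightarrow> 'x::real_normed_vector" and f1 f2
    using has_partials_isCont[OF that] by (simp add: continuous_at_imp_continuous_on)
  have "h u \<noteq> 0" for u using h_gt_1[of u] by simp
  then show "continuous_on UNIV F1" "continuous_on UNIV F2"
    unfolding F1_def[abs_def] F2_def[abs_def]
    by (intro continuous_intros cont[OF partials_h] cont[OF partials_h1] cont[OF partials_h2] cont[OF partials_Y1] cont[OF partials_Y2] cont[OF partials_F]; simp)+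
qed

text \<open>Chosen so that differentiation leads only to polynomials in them: the reciprocals are
  the denominators that occur. \<open>Q\<close> is available as
  \<open>C\<^sup>2 + S\<^sup>2\<close>, and \<open>psi\<close> is represented through its derivative
  \<open>P\<close> and through the sine and cosine of \<open>phi\<close>.\<close>

definition generators :: "(real^2 \<Rightarrow> real) set" where
  "generators = {\<lambda>u. C (u $ 1), \<lambda>u. S (u $ 1), \<lambda>u. R (u $ 1), \<lambda>u. P (u $ 1), \<lambda>u. 1 / Q (u $ 1),
     \<lambda>u. 1 / (W (u $ 1))\<^sup>2, \<lambda>u. 1 / (S (u $ 1) * C (u $ 1)), \<lambda>u. cosh (u $ 2), \<lambda>u. sinh (u $ 2),
     \<lambda>u. cos (phi u), \<lambda>u. sin (phi u), \<lambda>u. 1 / h u}"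

lemma generators_mem:
  "(\<lambda>u. C (u $ 1)) \<in> gen_algebra generators" "(\<lambda>u. S (u $ 1)) \<in> gen_algebra generators"
  "(\<lambda>u. R (u $ 1)) \<in> gen_algebra generators" "(\<lambda>u. P (u $ 1)) \<in> gen_algebra generators"
  "(\<lambda>u. 1 / Q (u $ 1)) \<in> gen_algebra generators" "(\<lambda>u. 1 / (W (u $ 1))\<^sup>2) \<in> gen_algebra generators"
  "(\<lambda>u. 1 / (S (u $ 1) * C (u $ 1))) \<in> gen_algebra generators"
  "(\<lambda>u. cosh (u $ 2)) \<in> gen_algebra generators" "(\<lambda>u. sinh (u $ 2)) \<in> gen_algebra generators"
  "(\<lambda>u. cos (phi u)) \<in> gen_algebra generators" "(\<lambda>u. sin (phi u)) \<in> gen_algebra generators"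
  "(\<lambda>u. 1 / h u) \<in> gen_algebra generators"
  by (rule gen_algebra.base, simp add: generators_def)+

lemmas generators_intros = generators_mem gen_algebra.add gen_algebra.mult gen_algebra.const

lemma generators_partials:
  assumes "b \<in> generators"
  shows "\<exists>b1\<in>gen_algebra generators. \<exists>b2\<in>gen_algebra generators. has_partials b b1 b2"
proof -
  have *: "\<exists>b1\<in>gen_algebra generators. \<exists>b2\<in>gen_algebra generators. has_partials b b1 b2"
    if "has_partials b b1 b2" "b1 \<in> gen_algebra generators" "b2 \<in> gen_algebra generators" for b b1 b2
    using that by blast
  have nzh: "h u \<noteq> 0" for u using h_gt_1[of u] by simp
  \<comment> \<open>The partial derivatives are restated with sums, products and constants only,
    because \<open>gen_algebra\<close> has no rule for differences or powers.\<close>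
  have R': "has_partials (\<lambda>u. R (u $ 1))
     (\<lambda>u. S (u $ 1) * C (u $ 1) * (1 + (-4) * (R (u $ 1) * R (u $ 1))) * (1 / Q (u $ 1))) (\<lambda>u. 0)"
    by (rule has_partials_cong[OF partials_R]) (simp_all add: R'_def power2_eq_square)
  have P': "has_partials (\<lambda>u. P (u $ 1))
     (\<lambda>u. P (u $ 1) * R (u $ 1) * ((1 + a\<^sup>2) * S (u $ 1) * C (u $ 1) * (1 / (W (u $ 1))\<^sup>2)
        + (-4) * S (u $ 1) * C (u $ 1) * (1 / Q (u $ 1))
        + ((-1) * (C (u $ 1) * C (u $ 1)) + (-1) * (S (u $ 1) * S (u $ 1))) * (1 / (S (u $ 1) * C (u $ 1))))) (\<lambda>u. 0)"
    by (rule has_partials_cong[OF partials_P]) (simp_all add: P'_def Q_eq power2_eq_square add_divide_distrib diff_divide_distrib)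
  have Q': "has_partials (\<lambda>u. 1 / Q (u $ 1))
     (\<lambda>u. (-4) * S (u $ 1) * C (u $ 1) * R (u $ 1) * ((1 / Q (u $ 1)) * (1 / Q (u $ 1)))) (\<lambda>u. 0)"
    by (rule has_partials_cong[OF has_partials_inverse[OF has_partials_fst[OF Q_deriv] nonzero(1)]])
      (simp_all add: power2_eq_square)
  have W': "has_partials (\<lambda>u. 1 / (W (u $ 1))\<^sup>2)
     (\<lambda>u. (-1) * (2 * (1 + a\<^sup>2) * S (u $ 1) * C (u $ 1) * R (u $ 1)) * ((1 / (W (u $ 1))\<^sup>2) * (1 / (W (u $ 1))\<^sup>2))) (\<lambda>u. 0)"
  proof -
    have D: "((\<lambda>p. (W p)\<^sup>2) has_real_derivative 2 * (1 + a\<^sup>2) * S p * C p * R p) (at p)" for p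
      using nonzero(4)[of p] by (auto intro!: derivative_eq_intros W_deriv)
    show ?thesis
      by (rule has_partials_cong[OF has_partials_inverse[OF has_partials_fst[OF D]]])
        (use nonzero(4) in \<open>simp_all add: power2_eq_square\<close>)
  qed
  have SC': "has_partials (\<lambda>u. 1 / (S (u $ 1) * C (u $ 1)))
     (\<lambda>u. (-1) * (C (u $ 1) * C (u $ 1) + S (u $ 1) * S (u $ 1)) * R (u $ 1) *
        ((1 / (S (u $ 1) * C (u $ 1))) * (1 / (S (u $ 1) * C (u $ 1))))) (\<lambda>u. 0)"
  proof -
    have eq: "- (x * r * x + y * (y * r)) / d\<^sup>2 = (-1) * (x * x + y * y) * r * (1 / d * (1 / d))"
      for x y r d :: real
      by (cases "d = 0") (simp_all add: field_simps power2_eq_square)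
    have "S (u $ 1) * C (u $ 1) \<noteq> 0" for u :: "real^2"
      using nonzero by simp
    then show ?thesis
      by (rule has_partials_cong[OF has_partials_inverse[OF has_partials_mult[OF partials_S partials_C]]]) (rule eq, simp)
  qed
  have cos': "has_partials (\<lambda>u. cos (phi u)) (\<lambda>u. (-1) * sin (phi u) * P (u $ 1)) (\<lambda>u. (-1) * sin (phi u) * a)"
    by (rule has_partials_cong[OF partials_cos_phi]) simp_all
  have h': "has_partials (\<lambda>u. 1 / h u)
     (\<lambda>u. (-1) * (S (u $ 1) * R (u $ 1) * cosh (u $ 2)) * ((1 / h u) * (1 / h u)))
     (\<lambda>u. (-1) * (C (u $ 1) * sinh (u $ 2)) * ((1 / h u) * (1 / h u)))"
    by (rule has_partials_cong[OF has_partials_inverse[OF partials_h nzh]])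
      (simp_all add: h1_def h2_def power2_eq_square)
  \<comment> \<open>The separate name \<open>G\<close> lets the quantified set be unfolded into its
    members while \<open>generators\<close> inside \<open>gen_algebra\<close> stays folded.\<close>
  have "\<forall>b\<in>G. \<exists>b1\<in>gen_algebra generators. \<exists>b2\<in>gen_algebra generators. has_partials b b1 b2"
    if "G = generators" for G
    unfolding that[unfolded generators_def] ball_simps
    by (intro conjI TrueI;
        rule *[OF partials_C] *[OF partials_S] *[OF R'] *[OF P'] *[OF Q'] *[OF W'] *[OF SC'] *[OF partials_cosh] *[OF partials_sinh] *[OF cos'] *[OF partials_sin_phi] *[OF h'];
        intro generators_intros)
  then show ?thesis using assms by blast
qed

lemma smooth_F: "smooth_on F X"
proof -
  have F_eq: "F = (\<lambda>u. vector [C (u $ 1) * sinh (u $ 2) * (1 / h u), S (u $ 1) * cos (phi u) * (1 / h u),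
      S (u $ 1) * sin (phi u) * (1 / h u)])"
    by (simp add: fun_eq_iff F_def Y_def vec_eq_iff forall_3)
  show ?thesis
    unfolding F_eq
    by (rule smooth_on_vector3_gen_algebra[where B = generators])
      (use generators_partials in blast, (intro generators_intros)+)
qed

theorem complete_minimal_surface_F: "complete_minimal_surface (range F)"
proof -
  have "immersion_hyp3 euclidean {(UNIV, id)} F"
    using norm_F smooth_F immersion_F by (auto simp: immersion_hyp3_def hyp3_def inv_id)
  then have "minimal_immersion euclidean {(UNIV, id)} F"
    by (simp add: minimal_immersion_def inv_id mean_curvature_F)
  moreover have "Metric_space.mcomplete UNIV (surface_dist euclidean {(UNIV, id)} F)"
    by (rule mcomplete_surface_dist[OF partials_F norm_F continuous_F1 continuous_F2 expansion_pos hyp_norm_F_ge])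
  ultimately show ?thesis
    unfolding complete_minimal_surface_def using smooth_surface_plane
    by (intro exI[of _ "euclidean :: (real^2) topology"] exI[of _ "{(UNIV, id)}"] exI[of _ F]) simp
qed

end

section \<open>Asymptotic boundary\<close>

text \<open>
  For a point of the unit sphere, \<open>artanh (y $ 1)\<close> is the coordinate \<open>t\<close>; the curve consists of two
  spirals, opposite to each other, and the two end points of the axis. There the value of \<open>artanh\<close>
  is arbitrary, but \<open>y $ 2 = y $ 3 = 0\<close>.
\<close>

definition helical_curve :: "real \<Rightarrow> (real^3) set" where
  "helical_curve a = {y. norm y = 1 \<and>
     y $ 2 * cos (a * artanh (y $ 1)) + y $ 3 * sin (a * artanh (y $ 1)) = 0}"

lemma norm_vec3_sq: "(norm (y :: real^3))\<^sup>2 = (y $ 1)\<^sup>2 + (y $ 2)\<^sup>2 + (y $ 3)\<^sup>2"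
  unfolding power2_norm_eq_inner by (simp add: inner_vec_def sum_3 power2_eq_square)

text \<open>The equation makes \<open>(x, y)\<close> orthogonal to the direction of angle
  \<open>b\<close>, so it is a signed multiple \<open>r\<close> of that direction turned by a right
  angle.\<close>

lemma rotate_back:
  fixes x y b :: real
  assumes "x * cos b + y * sin b = 0"
  defines "r \<equiv> y * cos b - x * sin b"
  shows "x = - (r * sin b)" "y = r * cos b" "x\<^sup>2 + y\<^sup>2 = r\<^sup>2"
proof -
  have sc: "(sin b)\<^sup>2 + (cos b)\<^sup>2 = 1" by simp
  show 1: "x = - (r * sin b)" and 2: "y = r * cos b"
    using assms(1) sc unfolding r_def by algebra+
  show "x\<^sup>2 + y\<^sup>2 = r\<^sup>2"
    unfolding 1 2 using sc by algebra
qed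

text \<open>The first coordinate is \<open>cos (2 * pi * s)\<close>, and the sign of the sine
  selects the spiral. Continuity is delicate only at the poles, where \<open>artanh\<close> blows
  up; there the spinning factors are bounded and multiplied by a sine that tends to 0.\<close>

lemma jordan_curve_helical_curve: "jordan_curve_at_infinity (helical_curve a)"
proof -
  define T where "T = (\<lambda>s::real. a * artanh (cos (2 * pi * s)))"
  define \<gamma> :: "real \<Rightarrow> real^3" where
    "\<gamma> = (\<lambda>s. vector [cos (2 * pi * s), - (sin (2 * pi * s) * sin (T s)), sin (2 * pi * s) * cos (T s)])"
  have osc: "isCont (\<lambda>s. sin (2 * pi * s) * g (T s)) s"
    if g: "\<And>x. isCont g x" "\<And>x. \<bar>g x\<bar> \<le> 1" for g :: "real \<Rightarrow> real" and s
  proof (cases "sin (2 * pi * s) = 0")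
    case True
    have "((\<lambda>s. sin (2 * pi * s) * g (T s)) \<longlongrightarrow> 0) (at s)"
    proof (rule tendsto_0_le[where K = 1])
      have "((\<lambda>s. sin (2 * pi * s)) \<longlongrightarrow> sin (2 * pi * s)) (at s)"
        by (intro tendsto_intros)
      then show "((\<lambda>s. sin (2 * pi * s)) \<longlongrightarrow> 0) (at s)" by (simp add: True)
      show "\<forall>\<^sub>F s in at s. norm (sin (2 * pi * s) * g (T s)) \<le> norm (sin (2 * pi * s)) * 1"
        using g(2) by (intro always_eventually) (simp add: abs_mult mult_left_le)
    qed
    then show ?thesis by (simp add: isCont_def True)
  next
    case False
    have "(cos (2 * pi * s))\<^sup>2 < 1"
      using False sin_cos_squared_add[of "2 * pi * s"] zero_less_power2[of "sin (2 * pi * s)"] by linarith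
    then have "cos (2 * pi * s) \<in> {-1<..<1}" by (simp add: abs_square_less_1 abs_less_iff)
    then have "isCont T s"
      unfolding T_def
      by (intro isCont_mult continuous_const isCont_o2[OF _ isCont_artanh] continuous_intros) auto
    then have "isCont (\<lambda>s. g (T s)) s" using isCont_o2[OF _ g(1)] by blast
    then show ?thesis by (intro continuous_intros)
  qed
  have "continuous_on {0..1} \<gamma>"
  proof (rule continuous_at_imp_continuous_on, rule ballI)
    fix s
    have "isCont (\<lambda>s. cos (2 * pi * s)) s"
      by (intro continuous_intros)
    then have "isCont (\<lambda>s. \<gamma> s $ i) s" for i
      using exhaust_3[of i] osc[of "\<lambda>x. - sin x" s] osc[of cos s]
      by (elim disjE) (simp_all add: \<gamma>_def)
    then show "isCont \<gamma> s"
      unfolding isCont_def by (intro vec_tendstoI)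
  qed
  then have path: "path \<gamma>" by (simp add: path_def)
  have r: "\<gamma> s $ 3 * cos (T s) - \<gamma> s $ 2 * sin (T s) = sin (2 * pi * s)" for s
  proof -
    have "(sin (T s))\<^sup>2 + (cos (T s))\<^sup>2 = 1" by simp
    then show ?thesis unfolding \<gamma>_def vector_3 by algebra
  qed
  have simple: "simple_path \<gamma>"
  proof (rule simple_pathI[OF path])
    fix x y :: real assume xy: "0 \<le> x" "x < y" "y \<le> 1" and eq: "\<gamma> x = \<gamma> y"
    then have "\<gamma> x $ 1 = \<gamma> y $ 1" by simp
    then have cos: "cos (2 * pi * y) = cos (2 * pi * x)" by (simp add: \<gamma>_def)
    then have "T x = T y" by (simp add: T_def)
    then have "sin (2 * pi * y) = sin (2 * pi * x)" using r[of x] r[of y] eq by simp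
    with cos obtain n :: int where "2 * pi * y = 2 * pi * x + 2 * pi * n"
      using sin_cos_eq_iff by blast
    then have "2 * pi * y = 2 * pi * (x + n)" by (simp add: algebra_simps)
    then have n: "y = x + n" by simp
    then have "n = 1" using xy by linarith
    then show "x = 0 \<and> y = 1" using n xy by auto
  qed
  have image: "path_image \<gamma> = helical_curve a"
  proof
    show "path_image \<gamma> \<subseteq> helical_curve a"
    proof
      fix y assume "y \<in> path_image \<gamma>"
      then obtain s where y: "y = \<gamma> s" by (auto simp: path_image_def)
      have sc: "(sin (T s))\<^sup>2 + (cos (T s))\<^sup>2 = 1" "(sin (2 * pi * s))\<^sup>2 + (cos (2 * pi * s))\<^sup>2 = 1" by simp_all
      have "(norm y)\<^sup>2 = 1" unfolding norm_vec3_sq y \<gamma>_def vector_3 using sc by algebra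
      then have "norm y = 1" by (simp add: power2_eq_1_iff) (smt (verit) norm_ge_zero)
      moreover have "a * artanh (y $ 1) = T s" by (simp add: y \<gamma>_def T_def)
      ultimately show "y \<in> helical_curve a"
        by (simp add: helical_curve_def) (simp add: y \<gamma>_def)
    qed
    show "helical_curve a \<subseteq> path_image \<gamma>"
    proof
      fix y assume y: "y \<in> helical_curve a"
      define b r where "b = a * artanh (y $ 1)" and "r = y $ 3 * cos b - y $ 2 * sin b"
      have rb: "y $ 2 = - (r * sin b)" "y $ 3 = r * cos b" "(y $ 2)\<^sup>2 + (y $ 3)\<^sup>2 = r\<^sup>2"
        using rotate_back[of "y $ 2" b "y $ 3"] y by (auto simp: helical_curve_def b_def r_def)
      have "(y $ 1)\<^sup>2 + r\<^sup>2 = 1"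
        using norm_vec3_sq[of y] y rb(3) by (simp add: helical_curve_def)
      then obtain t where t: "0 \<le> t" "t < 2 * pi" "y $ 1 = cos t" "r = sin t"
        by (rule sincos_total_2pi)
      define s where "s = t / (2 * pi)"
      have s: "2 * pi * s = t" "s \<in> {0..1}" using t by (auto simp: s_def divide_le_eq)
      have "T s = b" by (simp add: T_def b_def s t)
      then have "\<gamma> s = y" by (simp add: \<gamma>_def vec_eq_iff forall_3 s t rb)
      then show "y \<in> path_image \<gamma>" using s(2) by (auto simp: path_image_def)
    qed
  qed
  have "pathfinish \<gamma> = pathstart \<gamma>"
    by (simp add: pathfinish_def pathstart_def \<gamma>_def T_def)
  moreover have "helical_curve a \<subseteq> sphere_at_infinity"
    by (auto simp: helical_curve_def sphere_at_infinity_def)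
  ultimately show ?thesis
    unfolding jordan_curve_at_infinity_def using simple image by blast
qed

context screw_surface
begin

section \<open>Limits at the ends of the surface\<close>

lemma F_components:
  "F u $ 1 = C (u $ 1) * sinh (u $ 2) / h u" "F u $ 2 = S (u $ 1) * cos (phi u) / h u"
  "F u $ 3 = S (u $ 1) * sin (phi u) / h u"
  by (simp_all add: F_def Y_def)

text \<open>The argument of \<open>artanh\<close> is a coordinate of the Klein model, the quotient
  of a space coordinate by the time coordinate of the hyperboloid, here \<open>tanh t\<close>. In
  this form \<open>t\<close> extends continuously to the sphere away from the poles.\<close>

lemma axis_coordinate_F: "artanh (2 * F u $ 1 / (1 + (norm (F u))\<^sup>2)) = u $ 2"
proof -
  have h: "h u > 1" by (rule h_gt_1)
  have n: "(norm (F u))\<^sup>2 = 1 - 2 / h u"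
  proof -
    have "1 - (norm (F u))\<^sup>2 \<noteq> 0" using conformal_factor[of u] h by auto
    then have "2 = h u * (1 - (norm (F u))\<^sup>2)" using conformal_factor[of u] by (simp add: field_simps)
    then show ?thesis using h by (simp add: field_simps)
  qed
  have "1 + (norm (F u))\<^sup>2 = 2 * (C (u $ 1) * cosh (u $ 2)) / h u"
    using h by (simp add: n field_simps) (simp add: h_def)
  then have "2 * F u $ 1 / (1 + (norm (F u))\<^sup>2) = tanh (u $ 2)"
    using h nonzero(2)[of "u $ 1"] by (simp add: F_components tanh_def)
  then show ?thesis by (simp add: artanh_tanh_real)
qed

lemma tendsto_psi_at_top: "(psi \<longlongrightarrow> total_angle a c / 2) at_top"
  and tendsto_psi_at_bot: "(psi \<longlongrightarrow> - (total_angle a c / 2)) at_bot"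
proof -
  let ?I = "\<lambda>x. integral {- (pi/2)..x} (ang_vel a c)"
  have cont: "continuous_on {- (pi/2)..pi/2} ?I"
    by (intro indefinite_integral_continuous_1 integrable_continuous_real continuous_on_ang_vel' c_pos)
  have mem: "arctan (sinh p) \<in> {- (pi/2)..pi/2}" for p
    using arctan_bounded[of "sinh p"] by auto
  have "((\<lambda>p. ?I (arctan (sinh p))) \<longlongrightarrow> ?I (pi/2)) at_top"
    by (rule continuous_on_tendsto_compose[OF cont filterlim_compose[OF tendsto_arctan_at_top sinh_real_at_top]])
      (use mem in auto)
  then have "(psi \<longlongrightarrow> total_angle a c - total_angle a c / 2) at_top"
    unfolding psi_def[abs_def] total_angle_def by (rule tendsto_diff[OF _ tendsto_const])
  then show "(psi \<longlongrightarrow> total_angle a c / 2) at_top" by simp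
  have "((\<lambda>p. ?I (arctan (sinh p))) \<longlongrightarrow> ?I (- (pi/2))) at_bot"
    by (rule continuous_on_tendsto_compose[OF cont filterlim_compose[OF tendsto_arctan_at_bot sinh_real_at_bot]])
      (use mem in auto)
  then have "(psi \<longlongrightarrow> 0 - total_angle a c / 2) at_bot"
    unfolding psi_def[abs_def] by (intro tendsto_diff tendsto_const) simp
  then show "(psi \<longlongrightarrow> - (total_angle a c / 2)) at_bot" by simp
qed

text \<open>Stated for any filter along which \<open>cosh\<close> grows, so that it serves both
  ends; the growth comes from \<open>Q p \<ge> 2 * c * cosh p\<close>.\<close>

lemma tendsto_inverse_C:
  assumes "filterlim cosh at_top A"
  shows "((\<lambda>p. 1 / C p) \<longlongrightarrow> 0) A"
proof -
  have "2 * c * cosh p \<le> Q p" for p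
    unfolding Q_def by (rule real_le_rsqrt) (simp add: power_mult_distrib)
  moreover have "filterlim (\<lambda>p. 2 * c * cosh p) at_top A"
    by (rule filterlim_tendsto_pos_mult_at_top[OF tendsto_const _ assms]) (use c_pos in simp)
  ultimately have "filterlim Q at_top A"
    using filterlim_at_top_mono[of "\<lambda>p. 2 * c * cosh p" A Q] by simp
  from filterlim_tendsto_add_at_top[OF tendsto_const this]
  have "filterlim (\<lambda>p. 1/2 * (1 + Q p)) at_top A"
    by (rule filterlim_tendsto_pos_mult_at_top[OF tendsto_const, rotated]) simp
  then have "filterlim (\<lambda>p. (Q p + 1) / 2) at_top A"
    by (simp add: add.commute)
  then have "filterlim C at_top A"
    unfolding C_def[abs_def] by (rule filterlim_compose[OF sqrt_at_top])
  then show ?thesis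
    by (intro tendsto_divide_0[OF tendsto_const] filterlim_at_top_imp_at_infinity)
qed

text \<open>Dividing numerators and denominator by \<open>C p\<close> leaves \<open>S / C\<close>,
  which tends to 1, and \<open>1 / C\<close>, which tends to 0. For each fixed \<open>t\<close> the
  limit is the point of a boundary spiral at angle \<open>b + a * t\<close>.\<close>

lemma tendsto_F:
  assumes "filterlim cosh at_top A" "(psi \<longlongrightarrow> b) A"
  shows "((\<lambda>p. F (vector [p, t])) \<longlongrightarrow>
    vector [sinh t / cosh t, cos (b + a * t) / cosh t, sin (b + a * t) / cosh t]) A"
proof -
  note inv = tendsto_inverse_C[OF assms(1)]
  have "S p / C p = sqrt (1 - (1 / C p)\<^sup>2)" for p
  proof -
    have "(S p)\<^sup>2 = (C p)\<^sup>2 - 1" using C_S[of p] by simp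
    then have "(S p / C p)\<^sup>2 = 1 - (1 / C p)\<^sup>2"
      using nonzero(2)[of p] by (simp add: power_divide diff_divide_distrib)
    then show ?thesis
      using S_pos[of p] C_gt_1[of p] by (metis divide_nonneg_nonneg less_eq_real_def less_trans real_sqrt_unique zero_less_one)
  qed
  moreover have "((\<lambda>p. sqrt (1 - (1 / C p)\<^sup>2)) \<longlongrightarrow> sqrt (1 - 0\<^sup>2)) A"
    by (intro tendsto_intros inv)
  ultimately have SC: "((\<lambda>p. S p / C p) \<longlongrightarrow> 1) A" by simp
  have d: "((\<lambda>p. 1 / C p + cosh t) \<longlongrightarrow> 0 + cosh t) A"
    by (intro tendsto_intros inv)
  have ch: "0 + cosh t \<noteq> 0" by simp
  have "((\<lambda>p. vector [sinh t / (1 / C p + cosh t), S p / C p * cos (psi p + a * t) / (1 / C p + cosh t),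
      S p / C p * sin (psi p + a * t) / (1 / C p + cosh t)] :: real^3) \<longlongrightarrow>
    vector [sinh t / (0 + cosh t), 1 * cos (b + a * t) / (0 + cosh t), 1 * sin (b + a * t) / (0 + cosh t)]) A"
    (is "(?f \<longlongrightarrow> ?l) A")
  proof (rule vec_tendstoI)
    fix i :: 3
    have "((\<lambda>p. sinh t / (1 / C p + cosh t)) \<longlongrightarrow> sinh t / (0 + cosh t)) A"
      "((\<lambda>p. S p / C p * cos (psi p + a * t) / (1 / C p + cosh t)) \<longlongrightarrow> 1 * cos (b + a * t) / (0 + cosh t)) A"
      "((\<lambda>p. S p / C p * sin (psi p + a * t) / (1 / C p + cosh t)) \<longlongrightarrow> 1 * sin (b + a * t) / (0 + cosh t)) A"
      by (intro tendsto_divide[OF _ d ch] tendsto_mult SC tendsto_intros assms(2))+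
    then show "((\<lambda>p. ?f p $ i) \<longlongrightarrow> ?l $ i) A"
      using exhaust_3[of i] by (elim disjE) simp_all
  qed
  moreover have "F (vector [p, t]) = ?f p" for p
  proof -
    have "1 / C p + cosh t = h (vector [p, t]) / C p"
      using nonzero(2)[of p] by (simp add: h_def field_simps)
    then show ?thesis
      using nonzero(2)[of p] by (simp add: vec_eq_iff forall_3 F_components phi_def)
  qed
  ultimately show ?thesis by simp
qed

text \<open>Along the orbit \<open>p = 0\<close> the angle need not converge, but its sine and
  cosine are damped by \<open>1 / cosh t\<close>. This reaches the two end points of the
  axis.\<close>

lemma tendsto_F_pole:
  assumes "filterlim cosh at_top A" "(tanh \<longlongrightarrow> b) A"
  shows "((\<lambda>t. F (vector [0, t])) \<longlongrightarrow> vector [b, 0, 0]) A"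
proof -
  have inv: "((\<lambda>t. 1 / cosh t :: real) \<longlongrightarrow> 0) A"
    by (intro tendsto_divide_0[OF tendsto_const] filterlim_at_top_imp_at_infinity assms)
  have d: "((\<lambda>t. 1 / cosh t + C 0) \<longlongrightarrow> 0 + C 0) A"
    by (intro tendsto_intros inv)
  have C0: "0 + C 0 \<noteq> 0" using nonzero(2)[of 0] by simp
  have osc: "((\<lambda>t. g t * (1 / cosh t)) \<longlongrightarrow> 0) A" if "\<And>t. \<bar>g t\<bar> \<le> 1" for g :: "real \<Rightarrow> real"
    by (rule tendsto_0_le[OF inv, where K = 1])
      (use that in \<open>simp add: abs_mult mult_right_le_one_le divide_right_mono\<close>)
  have "((\<lambda>t. vector [C 0 * tanh t / (1 / cosh t + C 0),
      S 0 * (cos (phi (vector [0, t])) * (1 / cosh t)) / (1 / cosh t + C 0),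
      S 0 * (sin (phi (vector [0, t])) * (1 / cosh t)) / (1 / cosh t + C 0)] :: real^3) \<longlongrightarrow>
    vector [C 0 * b / (0 + C 0), S 0 * 0 / (0 + C 0), S 0 * 0 / (0 + C 0)]) A"
    (is "(?f \<longlongrightarrow> ?l) A")
  proof (rule vec_tendstoI)
    fix i :: 3
    have "((\<lambda>t. C 0 * tanh t / (1 / cosh t + C 0)) \<longlongrightarrow> C 0 * b / (0 + C 0)) A"
      "((\<lambda>t. S 0 * (cos (phi (vector [0, t])) * (1 / cosh t)) / (1 / cosh t + C 0)) \<longlongrightarrow> S 0 * 0 / (0 + C 0)) A"
      "((\<lambda>t. S 0 * (sin (phi (vector [0, t])) * (1 / cosh t)) / (1 / cosh t + C 0)) \<longlongrightarrow> S 0 * 0 / (0 + C 0)) A"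
      by (intro tendsto_divide[OF _ d C0] tendsto_mult osc tendsto_const assms; simp)+
    then show "((\<lambda>t. ?f t $ i) \<longlongrightarrow> ?l $ i) A"
      using exhaust_3[of i] by (elim disjE) simp_all
  qed
  moreover have "F (vector [0, t]) = ?f t" for t
  proof -
    have "1 / cosh t + C 0 = h (vector [0, t]) / cosh t"
      by (simp add: h_def field_simps)
    then show ?thesis
      by (simp add: vec_eq_iff forall_3 F_components tanh_def)
  qed
  ultimately show ?thesis using nonzero(2)[of 0] by simp
qed

text \<open>Away from the poles, approaching the sphere keeps \<open>t\<close> bounded while
  \<open>h\<close> tends to infinity. Hence \<open>C\<close>, and with it the absolute value of
  \<open>p\<close>, must become large, so \<open>cos (psi p)\<close> tends to
  \<open>cos (total_angle a c / 2) = 0\<close>.\<close>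

lemma closure_range_F_imp_helical_curve:
  assumes half: "cos (total_angle a c / 2) = 0"
    and y: "y \<in> closure (range F)" "norm y = 1"
  shows "y \<in> helical_curve a"
proof (cases "\<bar>y $ 1\<bar> < 1")
  case False
  have "(norm y)\<^sup>2 = 1" using y(2) by simp
  moreover have "1 \<le> (y $ 1)\<^sup>2" using False by (metis abs_square_less_1 not_less)
  ultimately have "y $ 2 = 0 \<and> y $ 3 = 0"
    using norm_vec3_sq[of y] by (smt (verit) zero_le_power2 zero_less_power2)
  then show ?thesis using y(2) by (simp add: helical_curve_def)
next
  case True
  define T where "T = (\<lambda>x :: real^3. artanh (2 * x $ 1 / (1 + (norm x)\<^sup>2)))"
  \<comment> \<open>The left side of the equation of \<open>helical_curve\<close>, extended into the
    ball. On the surface the rotation cancels the screw term \<open>a * t\<close> and leaves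
    \<open>cos (psi p)\<close> times a factor of absolute value at most 1.\<close>
  define G where "G = (\<lambda>x :: real^3. x $ 2 * cos (a * T x) + x $ 3 * sin (a * T x))"
  obtain x where x: "\<And>n. x n \<in> range F" "x \<longlonglongrightarrow> y"
    using y(1) unfolding closure_sequential by blast
  then have "\<forall>n. \<exists>v. x n = F v" by blast
  from choice[OF this] obtain u where "\<forall>n. x n = F (u n)" by blast
  then have u: "x = (\<lambda>n. F (u n))" by (simp add: fun_eq_iff)
  have Ty: "T y = artanh (y $ 1)" by (simp add: T_def y(2))
  have T_lim: "(\<lambda>n. T (x n)) \<longlonglongrightarrow> T y"
    unfolding T_def using True y(2)
    by (intro tendsto_artanh tendsto_divide tendsto_intros x(2)) (auto simp: add_nonneg_eq_0_iff)
  have Tx: "T (x n) = u n $ 2" for n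
    by (simp add: u T_def axis_coordinate_F)
  have G_lim: "(\<lambda>n. G (x n)) \<longlonglongrightarrow> G y"
    unfolding G_def by (intro tendsto_intros x(2) T_lim)
  have Gx: "G (x n) = S (u n $ 1) / h (u n) * cos (psi (u n $ 1))" for n
  proof -
    have "psi (u n $ 1) = phi (u n) - a * u n $ 2" by (simp add: phi_def)
    then have "cos (psi (u n $ 1)) = cos (phi (u n)) * cos (a * u n $ 2) + sin (phi (u n)) * sin (a * u n $ 2)"
      by (simp only: cos_diff)
    then show ?thesis unfolding G_def Tx unfolding u F_components by (simp add: algebra_simps add_divide_distrib)
  qed
  have le: "\<bar>G (x n)\<bar> \<le> \<bar>cos (psi (u n $ 1))\<bar>" for n
  proof -
    have "S (u n $ 1) \<le> C (u n $ 1)"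
      by (rule power2_le_imp_le) (use C_S[of "u n $ 1"] C_gt_1[of "u n $ 1"] in auto)
    also have "\<dots> \<le> C (u n $ 1) * cosh (u n $ 2)"
      using C_gt_1[of "u n $ 1"] cosh_real_ge_1[of "u n $ 2"] by (simp add: mult_le_cancel_left1)
    also have "\<dots> \<le> h (u n)" by (simp add: h_def)
    finally have "\<bar>S (u n $ 1) / h (u n)\<bar> \<le> 1"
      using S_pos[of "u n $ 1"] h_gt_1[of "u n"] by (simp add: divide_le_eq_1)
    then show ?thesis unfolding Gx abs_mult by (rule mult_left_le_one_le[rotated 2]) auto
  qed
  have "(\<lambda>n. G (x n)) \<longlonglongrightarrow> 0"
  proof (rule tendstoI)
    fix e :: real assume "e > 0"
    have top: "((\<lambda>p. cos (psi p)) \<longlongrightarrow> 0) at_top" and bot: "((\<lambda>p. cos (psi p)) \<longlongrightarrow> 0) at_bot"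
      using tendsto_cos[OF tendsto_psi_at_top] tendsto_cos[OF tendsto_psi_at_bot] half by simp_all
    obtain M1 where M1: "\<And>p. p \<ge> M1 \<Longrightarrow> \<bar>cos (psi p)\<bar> < e"
      using tendstoD[OF top \<open>e > 0\<close>] by (auto simp: eventually_at_top_linorder)
    obtain M2 where M2: "\<And>p. p \<le> M2 \<Longrightarrow> \<bar>cos (psi p)\<bar> < e"
      using tendstoD[OF bot \<open>e > 0\<close>] by (auto simp: eventually_at_bot_linorder)
    have "continuous_on {M2..M1} C"
      using C_deriv by (meson DERIV_isCont continuous_at_imp_continuous_on)
    then have "bounded (C ` {M2..M1})"
      by (intro compact_imp_bounded compact_continuous_image) auto
    then obtain K where K: "\<forall>p\<in>{M2..M1}. \<bar>C p\<bar> \<le> K"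
      by (auto simp: bounded_iff)
    \<comment> \<open>An upper bound for \<open>h\<close> while \<open>p\<close> lies in the middle
      interval and \<open>t\<close> is close to its limit. It contradicts the growth of
      \<open>h = 2 / (1 - (norm x)\<^sup>2)\<close> near the sphere.\<close>
    define L where "L = 1 + \<bar>K\<bar> * (cosh (T y) + 1)"
    have L: "L \<ge> 1" by (simp add: L_def)
    have "(\<lambda>n. cosh (T (x n))) \<longlonglongrightarrow> cosh (T y)"
      by (intro tendsto_intros T_lim)
    then have E1: "\<forall>\<^sub>F n in sequentially. cosh (T (x n)) < cosh (T y) + 1"
      by (rule order_tendstoD) simp
    have "(\<lambda>n. L * (1 - (norm (x n))\<^sup>2)) \<longlonglongrightarrow> L * (1 - (norm y)\<^sup>2)"
      by (intro tendsto_intros x(2))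
    then have E2: "\<forall>\<^sub>F n in sequentially. L * (1 - (norm (x n))\<^sup>2) < 2"
      by (rule order_tendstoD) (simp add: y(2))
    from E1 E2 show "\<forall>\<^sub>F n in sequentially. dist (G (x n)) 0 < e"
    proof eventually_elim
      case (elim n)
      have "u n $ 1 \<notin> {M2..M1}"
      proof
        assume "u n $ 1 \<in> {M2..M1}"
        then have "C (u n $ 1) \<le> \<bar>K\<bar>" using K by fastforce
        then have "C (u n $ 1) * cosh (u n $ 2) \<le> \<bar>K\<bar> * (cosh (T y) + 1)"
          using elim(1) C_gt_1[of "u n $ 1"] by (intro mult_mono) (auto simp: Tx)
        then have hL: "h (u n) \<le> L" by (simp add: h_def L_def)
        have pos: "1 - (norm (x n))\<^sup>2 > 0"
          using norm_F[of "u n"] abs_square_less_1[of "norm (F (u n))"] by (simp add: u)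
        then have "2 = h (u n) * (1 - (norm (x n))\<^sup>2)"
          using conformal_factor[of "u n"] by (simp add: u field_simps)
        also have "\<dots> \<le> L * (1 - (norm (x n))\<^sup>2)" using hL pos by (intro mult_right_mono) auto
        finally show False using elim(2) by simp
      qed
      then have "\<bar>cos (psi (u n $ 1))\<bar> < e" using M1 M2 by force
      then show ?case using le[of n] by simp
    qed
  qed
  then have "G y = 0" using G_lim LIMSEQ_unique by blast
  then show ?thesis using y(2) by (simp add: helical_curve_def G_def Ty)
qed

lemma helical_curve_imp_closure_range_F:
  assumes half: "cos (total_angle a c / 2) = 0"
    and y: "y \<in> helical_curve a"
  shows "y \<in> closure (range F)"
proof -
  have limI: "l \<in> closure (range F)" if "((\<lambda>p. F (g p)) \<longlongrightarrow> l) A" "A \<noteq> bot" for g :: "real \<Rightarrow> real^2" and A l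
  proof (rule Lim_in_closed_set[OF closed_closure _ that(2,1)])
    show "\<forall>\<^sub>F p in A. F (g p) \<in> closure (range F)"
      using closure_subset[of "range F"] by (intro always_eventually) auto
  qed
  have norm: "(y $ 1)\<^sup>2 + (y $ 2)\<^sup>2 + (y $ 3)\<^sup>2 = 1"
    using y norm_vec3_sq[of y] by (simp add: helical_curve_def)
  show ?thesis
  proof (cases "\<bar>y $ 1\<bar> < 1")
    case False
    have "(y $ 1)\<^sup>2 \<ge> 1" using False by (metis abs_square_less_1 not_less)
    then have y23: "y $ 2 = 0" "y $ 3 = 0" and y1: "(y $ 1)\<^sup>2 = 1"
      using norm by (smt (verit) zero_le_power2 zero_less_power2)+
    from y1 consider "y $ 1 = 1" | "y $ 1 = - 1" by (auto simp: power2_eq_1_iff)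
    then show ?thesis
    proof cases
      case 1
      then have "y = vector [1, 0, 0]" using y23 by (simp add: vec_eq_iff forall_3)
      then show ?thesis using limI[OF tendsto_F_pole[OF cosh_real_at_top tanh_real_at_top]] by simp
    next
      case 2
      then have "y = vector [- 1, 0, 0]" using y23 by (simp add: vec_eq_iff forall_3)
      then show ?thesis using limI[OF tendsto_F_pole[OF cosh_real_at_bot tanh_real_at_bot]] by simp
    qed
  next
    case True
    have pos: "1 - (y $ 1)\<^sup>2 > 0" using True by (simp add: abs_square_less_1)
    define t where "t = arsinh (y $ 1 / sqrt (1 - (y $ 1)\<^sup>2))"
    have sinh: "sinh t = y $ 1 / sqrt (1 - (y $ 1)\<^sup>2)" by (simp add: t_def)
    have "(cosh t)\<^sup>2 = (1 / sqrt (1 - (y $ 1)\<^sup>2))\<^sup>2"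
      unfolding cosh_square_eq sinh using pos by (simp add: power_divide field_simps)
    then have cosh: "cosh t = 1 / sqrt (1 - (y $ 1)\<^sup>2)"
      using pos by (simp add: power2_eq_iff_nonneg)
    have y1: "y $ 1 = sinh t / cosh t" using pos by (simp add: sinh cosh)
    then have t: "artanh (y $ 1) = t" by (simp add: artanh_tanh_real flip: tanh_def)
    define r where "r = y $ 3 * cos (a * t) - y $ 2 * sin (a * t)"
    have rb: "y $ 2 = - (r * sin (a * t))" "y $ 3 = r * cos (a * t)" "(y $ 2)\<^sup>2 + (y $ 3)\<^sup>2 = r\<^sup>2"
      using rotate_back[of "y $ 2" "a * t" "y $ 3"] y t by (auto simp: helical_curve_def r_def)
    \<comment> \<open>This is 1 or -1. A shift of the angle by half the total angle is then a
      right-angle turn with sign \<open>s\<close>, so the sign of \<open>r\<close> tells which end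
      of the surface approaches \<open>y\<close>.\<close>
    define s where "s = sin (total_angle a c / 2)"
    have s2: "s\<^sup>2 = 1" using half sin_cos_squared_add[of "total_angle a c / 2"] by (simp add: s_def)
    have "r\<^sup>2 = (1 / cosh t)\<^sup>2" using rb(3) norm pos by (simp add: cosh)
    then have "(r * cosh t)\<^sup>2 = s\<^sup>2" using s2 by (simp add: power_mult_distrib power_divide)
    then consider "r * cosh t = s" | "r * cosh t = - s" by (auto simp: power2_eq_iff)
    then show ?thesis
    proof cases
      case 1
      then have r: "r = s / cosh t" by (simp add: field_simps)
      have "y = vector [sinh t / cosh t, cos (total_angle a c / 2 + a * t) / cosh t, sin (total_angle a c / 2 + a * t) / cosh t]"
        by (simp add: vec_eq_iff forall_3 y1 rb r cos_add sin_add half s_def)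
      then show ?thesis using limI[OF tendsto_F[OF cosh_real_at_top tendsto_psi_at_top]] by simp
    next
      case 2
      then have r: "r = - s / cosh t" by (simp add: field_simps)
      have "y = vector [sinh t / cosh t, cos (- (total_angle a c / 2) + a * t) / cosh t, sin (- (total_angle a c / 2) + a * t) / cosh t]"
        unfolding cos_add sin_add cos_minus sin_minus half
        by (simp add: vec_eq_iff forall_3 y1 rb r s_def)
      then show ?thesis using limI[OF tendsto_F[OF cosh_real_at_bot tendsto_psi_at_bot]] by simp
    qed
  qed
qed

lemma asymptotic_boundary_F:
  assumes "cos (total_angle a c / 2) = 0"
  shows "asymptotic_boundary (range F) = helical_curve a"
proof -
  have "y \<in> sphere_at_infinity \<longleftrightarrow> norm y = 1" for y
    by (simp add: sphere_at_infinity_def)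
  moreover have "norm y = 1" if "y \<in> helical_curve a" for y
    using that by (simp add: helical_curve_def)
  ultimately show ?thesis
    unfolding asymptotic_boundary_def
    using closure_range_F_imp_helical_curve[OF assms] helical_curve_imp_closure_range_F[OF assms] by blast
qed

section \<open>Distinctness of the surfaces\<close>

text \<open>The conformal factor undoes the projection. The squared hyperbolic sine of the distance
  to the axis is thereby read off from the point alone, independently of the
  parametrisation.\<close>

lemma axis_distance_F:
  "(2 / (1 - (norm (F u))\<^sup>2) * F u $ 2)\<^sup>2 + (2 / (1 - (norm (F u))\<^sup>2) * F u $ 3)\<^sup>2 = (S (u $ 1))\<^sup>2"
proof -
  have "h u \<noteq> 0" using h_gt_1[of u] by simp
  then have "h u * F u $ 2 = S (u $ 1) * cos (phi u)" "h u * F u $ 3 = S (u $ 1) * sin (phi u)"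
    by (simp_all add: F_components)
  moreover have "(sin (phi u))\<^sup>2 + (cos (phi u))\<^sup>2 = 1" by simp
  ultimately show ?thesis unfolding conformal_factor by algebra
qed

lemma S_sq_eq: "(S p)\<^sup>2 * ((S p)\<^sup>2 + 1) = c\<^sup>2 * (cosh p)\<^sup>2"
  unfolding C_S[symmetric] power_mult_distrib[symmetric] SC ..

end

text \<open>By \<open>S_sq_eq\<close>, \<open>c\<^sup>2\<close> is the least value of
  \<open>sinh\<^sup>2 r * cosh\<^sup>2 r\<close> on the surface and is attained at
  \<open>p = 0\<close>. A point of the first surface that realises it also lies on the second, where
  the values are at least \<open>c'\<^sup>2\<close>.\<close>

lemma screw_surface_range_F_le:
  assumes "screw_surface c" "screw_surface c'" "range (screw_surface.F a c) = range (screw_surface.F a c')"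
  shows "c' \<le> c"
proof -
  interpret A: screw_surface a c by fact
  interpret B: screw_surface a c' by fact
  have "A.F 0 \<in> range B.F" unfolding assms(3)[symmetric] by (rule rangeI)
  then obtain u where u: "A.F 0 = B.F u" by (rule rangeE)
  have "(A.S 0)\<^sup>2 = (B.S (u $ 1))\<^sup>2"
    using A.axis_distance_F[of 0] B.axis_distance_F[of u] by (simp add: u)
  then have "c\<^sup>2 = c'\<^sup>2 * (cosh (u $ 1))\<^sup>2"
    using A.S_sq_eq[of 0] B.S_sq_eq[of "u $ 1"] by (simp only: cosh_0 power_one mult_1_right)
  moreover have "c'\<^sup>2 * 1 \<le> c'\<^sup>2 * (cosh (u $ 1))\<^sup>2"
    using cosh_real_ge_1[of "u $ 1"] by (intro mult_left_mono one_le_power) auto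
  ultimately have "c'\<^sup>2 \<le> c\<^sup>2" by simp
  then show ?thesis by (rule power2_le_imp_le) (use A.c_pos in simp)
qed

theorem theorem1p2:
  fixes N :: nat
  assumes "N > 0"
  shows "\<exists>\<Lambda>. jordan_curve_at_infinity \<Lambda> \<and>
           (\<exists>F. finite F \<and> card F \<ge> 2 ^ N \<and>
              (\<forall>S\<in>F. complete_minimal_surface S \<and> asymptotic_boundary S = \<Lambda>))"
proof -
  define M :: nat where "M = 2 ^ N"
  define a where "a = 2 * pi * (2 * real M + 1)"
  have "\<forall>k. \<exists>c. k < M \<longrightarrow> c \<ge> 1 \<and> total_angle a c = pi * (2 * real k + 1)"
    using total_angle_values[OF a_def] by blast
  from choice[OF this] obtain c where
    "\<forall>k. k < M \<longrightarrow> c k \<ge> 1 \<and> total_angle a (c k) = pi * (2 * real k + 1)" by blast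
  then have c: "c k \<ge> 1" "total_angle a (c k) = pi * (2 * real k + 1)" if "k < M" for k
    using that by blast+
  define \<F> where "\<F> = (\<lambda>k. range (screw_surface.F a (c k))) ` {..<M}"
  have scr: "screw_surface (c k)" if "k < M" for k
    using c(1)[OF that] by unfold_locales simp
  \<comment> \<open>Equal images force equal Clairaut constants, hence equal total angles, and these
    determine \<open>k\<close>.\<close>
  have "inj_on (\<lambda>k. range (screw_surface.F a (c k))) {..<M}"
  proof (rule inj_onI)
    fix k l assume kl: "k \<in> {..<M}" "l \<in> {..<M}"
      and eq: "range (screw_surface.F a (c k)) = range (screw_surface.F a (c l))"
    have kl': "k < M" "l < M" using kl by simp_all
    have "c k \<le> c l" by (rule screw_surface_range_F_le[OF scr[OF kl'(2)] scr[OF kl'(1)] eq[symmetric]])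
    moreover have "c l \<le> c k" by (rule screw_surface_range_F_le[OF scr[OF kl'(1)] scr[OF kl'(2)] eq])
    ultimately have "total_angle a (c k) = total_angle a (c l)" by simp
    then have "real k = real l" unfolding c(2)[OF kl'(1)] c(2)[OF kl'(2)] by simp
    then show "k = l" by simp
  qed
  then have "card \<F> = 2 ^ N" by (simp add: \<F>_def card_image M_def)
  moreover have "complete_minimal_surface S \<and> asymptotic_boundary S = helical_curve a" if "S \<in> \<F>" for S
  proof -
    from that obtain k where k: "k < M" "S = range (screw_surface.F a (c k))"
      by (auto simp: \<F>_def)
    interpret screw_surface a "c k" using scr[OF k(1)] .
    \<comment> \<open>Half of an odd multiple of pi is a zero of the cosine: this is where the
      parity of the multiple enters.\<close>
    have "cos (total_angle a (c k) / 2) = cos (real k * pi + pi / 2)"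
      by (simp add: c(2)[OF k(1)] algebra_simps add_divide_distrib)
    also have "\<dots> = 0" by (simp add: cos_add sin_npi)
    finally show ?thesis using complete_minimal_surface_F asymptotic_boundary_F by (simp add: k(2))
  qed
  moreover have "finite \<F>" by (simp add: \<F>_def)
  ultimately show ?thesis
    by (intro exI[of _ "helical_curve a"] conjI jordan_curve_helical_curve exI[of _ \<F>]) auto
qed

end
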